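(* Let $\mathcal X,\mathcal Y$ be nonempty convex compact sets and $\mathcal L:\mathcal X\times\mathcal Y\to\mathbb R$ a differentiable, uniformly strongly convex-concave function with saddle point $(x^*,y^* )$ and finite curvature constant $C_{\mathcal L}$. Consider one of two cases: (I) $(x^*,y^* )$ lies in the relative interior of $\mathcal X\times\mathcal Y$, $\mu_{\mathcal L}^{int}>0$, and we set $(g_t,\nu,\mu_{\mathcal L}):=(g_t^{FW},\nu^{FW},\mu_{\mathcal L}^{int})$ with $\nu^{FW}:=1-\frac{M_{\mathcal L}}{\sqrt{\mu^{int}_{\mathcal L}}}$, the algorithm being SP-FW; or (P) $\mathcal X=\mathrm{conv}(\mathcal A)$, $\mathcal Y=\mathrm{conv}(\mathcal B)$ with $\mathcal A,\mathcal B$ finite, $\mu^A_{\mathcal L}>0$, and we set $(g_t,\nu,\mu_{\mathcal L}):=(g_t^{PFW},\nu^{PFW},\mu^A_{\mathcal L})$ with $\nu^{PFW}:=\frac12-\frac{M_{\mathcal L}}{\sqrt{\mu^A_{\mathcal L}}}$, the algorithm being SP-AFW. If $\nu>0$, then the iterates $z^{(t)}$ of the algorithm with step size $\gamma_t=\min(\gamma_{\max},\frac{\nu}{2C_{\mathcal L}}g_t)$ satisfy $$h(z^{(t)})\le P_{\mathcal L}\sqrt{2w_0}\,(1-\rho_{\mathcal L})^{k(t)/2},\qquad \rho_{\mathcal L}:=\frac{\nu^2\mu_{\mathcal L}}{2C_{\mathcal L}},$$ where $w_0:=w(z^{(0)})$ and $k(t)$ is the number of non-drop steps after $t$ steps;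 for SP-FW $k(t)=t$ and for SP-AFW $k(t)\ge t/3$. Moreover, for all $T\in\mathbb N$, $$\min_{t\le T}g_t\le\frac{2\max\{\sqrt{C_{\mathcal L}},\sqrt{w_0}(1-\rho_{\mathcal L})^{k(T)/2}\}}{\nu}\sqrt{w_0}(1-\rho_{\mathcal L})^{k(T)/2}.$$
   Context: Notation: norms $\|\cdot\|_{\mathcal X},\|\cdot\|_{\mathcal Y}$ with duals $\|\cdot\|_{\mathcal X^*},\|\cdot\|_{\mathcal Y^*}$ (Euclidean norms when pyramidal widths are involved). Convex-concave: $\mathcal L(\cdot,y)$ convex, $\mathcal L(x,\cdot)$ concave. Uniformly strongly convex-concave: there are $\mu_{\mathcal X},\mu_{\mathcal Y}>0$ with $\mathcal L(\cdot,y)$ $\mu_{\mathcal X}$-strongly convex for every $y$ and $-\mathcal L(x,\cdot)$ $\mu_{\mathcal Y}$-strongly convex for every $x$. Saddle point: $\mathcal L(x^*,y)\le\mathcal L(x^*,y^* )\le\mathcal L(x,y^* )$ for all $x,y$; $\mathcal L^*:=\mathcal L(x^*,y^* )$. For $z=(x,y)$: $r(z):=(\nabla_x\mathcal L(z),-\nabla_y\mathcal L(z))$, $h(z):=\max_{y'}\mathcal L(x,y')-\min_{x'}\mathcal L(x',y)$, $w(z):=\mathcal L(x,y^* )-\mathcal L(x^*,y)$. Algorithms. SP-FW: from $z^{(0)}$, at iteration $t$: $r^{(t)}:=r(z^{(t)})$, $s^{(t)}\in\arg\min_{s\in\mathcal X\times\mathcal Y}\langle s,r^{(t)}\rangle$,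 $g_t^{FW}:=\langle z^{(t)}-s^{(t)},r^{(t)}\rangle$, $z^{(t+1)}:=(1-\gamma_t)z^{(t)}+\gamma_ts^{(t)}$; here $\gamma_{\max}:=1$ and all steps are non-drop. SP-AFW: iterates stored as $x^{(t)}=\sum_{v\in S_x^{(t)}}\alpha_v^{(t)}v$, $y^{(t)}=\sum_{v\in S_y^{(t)}}\alpha^{(t)}_vv$ (positive weights summing to one, active sets $S_x^{(t)}\subseteq\mathcal A,S_y^{(t)}\subseteq\mathcal B$), starting from $z^{(0)}\in\mathcal A\times\mathcal B$ with singleton active sets. At iteration $t$: $d_{FW}^{(t)}:=s^{(t)}-z^{(t)}$; $v^{(t)}=(v^{(t)}_x,v^{(t)}_y)\in\arg\max_{v\in S_x^{(t)}\times S_y^{(t)}}\langle r^{(t)},v\rangle$, $d_A^{(t)}:=z^{(t)}-v^{(t)}$; if $\langle-r^{(t)},d^{(t)}_{FW}\rangle\ge\langle-r^{(t)},d^{(t)}_A\rangle$ then $d^{(t)}:=d^{(t)}_{FW}$, $\gamma_{\max}:=1$, else $d^{(t)}:=d^{(t)}_A$, $\gamma_{\max}:=\min\{\frac{\alpha_{v_x^{(t)}}}{1-\alpha_{v_x^{(t)}}},\frac{\alpha_{v_y^{(t)}}}{1-\alpha_{v_y^{(t)}}}\}$; $g^{FW}_t:=\langle-r^{(t)},d^{(t)}_{FW}\rangle$, $g_t^{PFW}:=\langle-r^{(t)},d^{(t)}_{FW}+d^{(t)}_A\rangle$; $z^{(t+1)}:=z^{(t)}+\gamma_td^{(t)}$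 with $\gamma_t\in[0,\gamma_{\max}]$, weights of each block updated accordingly (FW step: multiply by $1-\gamma_t$, add $\gamma_t$ to the FW vertex; away step: multiply by $1+\gamma_t$, subtract $\gamma_t$ from the away vertex), active sets = atoms of positive weight. A drop step is an away step with $\gamma_t=\gamma_{\max}$. Constants. $\mathcal F:=\{\mathcal L(\cdot,y):y\in\mathcal Y\}$, $\mathcal G:=\{-\mathcal L(x,\cdot):x\in\mathcal X\}$. Curvature of convex $f$ on convex compact $\mathcal K$: $C_f:=\sup\frac2{\gamma^2}(f(x+\gamma(s-v))-f(x)-\gamma\langle s-v,\nabla f(x)\rangle)$ over $x,s,v\in\mathcal K$, $\gamma>0$ with $x+\gamma(s-v)\in\mathcal K$; $C_{\mathcal L}:=\frac12(\sup_{f\in\mathcal F}C_f+\sup_{g\in\mathcal G}C_g)$. Interior strong convexity of $f$ w.r.t. $x_c$ in the relative interior of $\mathcal K$: $\mu_f^{x_c}:=\inf\frac2{\gamma^2}(f(u)-f(x)-\langle u-x,\nabla f(x)\rangle)$ over $x\in\mathcal K\setminus\{x_c\}$, $\gamma\in(0,1]$, $u=x+\gamma(s-x)$ where $s$ is the point where the ray from $x$ through $x_c$ meets the relative boundary of $\mathcal K$; $\mu^{int}_{\mathcal L}:=\min\{\inf_{f\in\mathcal F}\mu_f^{x^*},\inf_{g\in\mathcal G}\mu_g^{y^*}\}$. Geometric strong convexity of $f$ on $\mathcal K=\mathrm{conv}(\mathcal A)$: for $x\in\mathcal K$, $\mathcal S_x$ is the family of $S\subseteq\mathcal A$ such that $x$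 is a convex combination of all elements of $S$ with positive coefficients, $v_S(x)\in\arg\max_{v\in S}\langle\nabla f(x),v\rangle$, $v_f(x)\in\arg\min\{\langle\nabla f(x),v\rangle:v=v_S(x),S\in\mathcal S_x\}$, $s_f(x)\in\arg\min_{v\in\mathcal A}\langle\nabla f(x),v\rangle$, $\gamma^A(x,x'):=\frac{\langle-\nabla f(x),x'-x\rangle}{\langle-\nabla f(x),s_f(x)-v_f(x)\rangle}$, and $\mu^A_f:=\inf_{x\in\mathcal K}\inf_{x'\in\mathcal K:\langle\nabla f(x),x'-x\rangle<0}\frac2{\gamma^A(x,x')^2}(f(x')-f(x)-\langle x'-x,\nabla f(x)\rangle)$; $\mu^A_{\mathcal L}:=\min\{\inf_{f\in\mathcal F}\mu^A_f\text{ (over }\mathcal A),\inf_{g\in\mathcal G}\mu^A_g\text{ (over }\mathcal B)\}$. Bilinearity coefficients: $M_{XY}:=\sup\langle s-v,\frac{\nabla_x\mathcal L(x,y^* )-\nabla_x\mathcal L(x,y)}{\sqrt{\mathcal L^*-\mathcal L(x^*,y)}}\rangle$ over $y\in\mathcal Y\setminus\{y^*\}$, $x,s,v\in\mathcal X$; $M_{YX}:=\sup\langle s-v,\frac{\nabla_y\mathcal L(x,y)-\nabla_y\mathcal L(x^*,y)}{\sqrt{\mathcal L(x,y^* )-\mathcal L^*}}\rangle$ over $x\in\mathcal X\setminus\{x^*\}$, $y,s,v\in\mathcal Y$; $M_{\mathcal L}:=\max\{M_{XY},M_{YX}\}$. With $\hat y(x):=\arg\max_{y}\mathcal L(x,y)$,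 $\hat x(y):=\arg\min_x\mathcal L(x,y)$: $P_{\mathcal X}:=\sup_{x\ne x^*}\frac{\langle\nabla_x\mathcal L(x,\hat y(x)),x-x^*\rangle}{\sqrt{\mathcal L(x,y^* )-\mathcal L^*}}$, $P_{\mathcal Y}:=\sup_{y\ne y^*}\frac{\langle\nabla_y\mathcal L(\hat x(y),y),y^*-y\rangle}{\sqrt{\mathcal L^*-\mathcal L(x^*,y)}}$, $P_{\mathcal L}:=\max\{P_{\mathcal X},P_{\mathcal Y}\}$. *)

theory Defs
  imports "HOL-Analysis.Analysis"
begin

definition strongly_convex_on :: "'a::real_normed_vector set \<Rightarrow> real \<Rightarrow> ('a \<Rightarrow> real) \<Rightarrow> bool" where
  "strongly_convex_on K \<mu> f \<longleftrightarrow>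
     (\<forall>a\<in>K. \<forall>b\<in>K. \<forall>l::real. 0 \<le> l \<and> l \<le> 1 \<longrightarrow>
        f (l *\<^sub>R a + (1 - l) *\<^sub>R b) \<le> l * f a + (1 - l) * f b - \<mu> / 2 * l * (1 - l) * (norm (a - b))\<^sup>2)"

definition curv_set :: "('a::real_inner \<Rightarrow> real) \<Rightarrow> ('a \<Rightarrow> 'a) \<Rightarrow> 'a set \<Rightarrow> real set" where
  "curv_set f df K = {2 / \<gamma>\<^sup>2 * (f (x + \<gamma> *\<^sub>R (s - v)) - f x - \<gamma> * ((s - v) \<bullet> df x)) | x s v \<gamma>.
      x \<in> K \<and> s \<in> K \<and> v \<in> K \<and> 0 < \<gamma> \<and> x + \<gamma> *\<^sub>R (s - v) \<in> K}"

definition curvature :: "('a::real_inner \<Rightarrow> real) \<Rightarrow> ('a \<Rightarrow> 'a) \<Rightarrow> 'a set \<Rightarrow> ereal" where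
  "curvature f df K = Sup (ereal ` curv_set f df K)"

definition curv_L :: "'a::real_inner set \<Rightarrow> 'b::real_inner set \<Rightarrow> ('a \<Rightarrow> 'b \<Rightarrow> real)
    \<Rightarrow> ('a \<Rightarrow> 'b \<Rightarrow> 'a) \<Rightarrow> ('a \<Rightarrow> 'b \<Rightarrow> 'b) \<Rightarrow> ereal" where
  "curv_L X Y L Gx Gy =
     ((SUP y\<in>Y. curvature (\<lambda>x. L x y) (\<lambda>x. Gx x y) X)
      + (SUP x\<in>X. curvature (\<lambda>y. - L x y) (\<lambda>y. - Gy x y) Y)) / 2"

definition mu_int_set :: "('a::euclidean_space \<Rightarrow> real) \<Rightarrow> ('a \<Rightarrow> 'a) \<Rightarrow> 'a set \<Rightarrow> 'a \<Rightarrow> real set" where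
  "mu_int_set f df K xc = {2 / \<gamma>\<^sup>2 * (f u - f x - (u - x) \<bullet> df x) | x \<gamma> s l u.
      x \<in> K \<and> x \<noteq> xc \<and> 0 < \<gamma> \<and> \<gamma> \<le> 1 \<and>
      s \<in> rel_frontier K \<and> 1 \<le> l \<and> s = x + l *\<^sub>R (xc - x) \<and>
      u = x + \<gamma> *\<^sub>R (s - x)}"

definition mu_int :: "('a::euclidean_space \<Rightarrow> real) \<Rightarrow> ('a \<Rightarrow> 'a) \<Rightarrow> 'a set \<Rightarrow> 'a \<Rightarrow> ereal" where
  "mu_int f df K xc = Inf (ereal ` mu_int_set f df K xc)"

definition mu_int_L :: "'a::euclidean_space set \<Rightarrow> 'b::euclidean_space set \<Rightarrow> ('a \<Rightarrow> 'b \<Rightarrow> real)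
    \<Rightarrow> ('a \<Rightarrow> 'b \<Rightarrow> 'a) \<Rightarrow> ('a \<Rightarrow> 'b \<Rightarrow> 'b) \<Rightarrow> 'a \<Rightarrow> 'b \<Rightarrow> ereal" where
  "mu_int_L X Y L Gx Gy xs ys =
     min (INF y\<in>Y. mu_int (\<lambda>x. L x y) (\<lambda>x. Gx x y) X xs)
         (INF x\<in>X. mu_int (\<lambda>y. - L x y) (\<lambda>y. - Gy x y) Y ys)"

definition conv_reps :: "'a::real_vector set \<Rightarrow> 'a \<Rightarrow> 'a set set" where
  "conv_reps A x = {S. S \<subseteq> A \<and> (\<exists>c. (\<forall>v\<in>S. 0 < c v) \<and> sum c S = 1 \<and> (\<Sum>v\<in>S. c v *\<^sub>R v) = x)}"

definition v_S :: "('a::real_inner \<Rightarrow> 'a) \<Rightarrow> 'a \<Rightarrow> 'a set \<Rightarrow> 'a" where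
  "v_S df x S = (SOME v. v \<in> S \<and> (\<forall>u\<in>S. df x \<bullet> u \<le> df x \<bullet> v))"

definition v_f :: "('a::real_inner \<Rightarrow> 'a) \<Rightarrow> 'a set \<Rightarrow> 'a \<Rightarrow> 'a" where
  "v_f df A x = (SOME v. v \<in> {v_S df x S | S. S \<in> conv_reps A x} \<and>
      (\<forall>S\<in>conv_reps A x. df x \<bullet> v \<le> df x \<bullet> v_S df x S))"

definition s_f :: "('a::real_inner \<Rightarrow> 'a) \<Rightarrow> 'a set \<Rightarrow> 'a \<Rightarrow> 'a" where
  "s_f df A x = (SOME v. v \<in> A \<and> (\<forall>u\<in>A. df x \<bullet> v \<le> df x \<bullet> u))"

definition gamma_A :: "('a::real_inner \<Rightarrow> 'a) \<Rightarrow> 'a set \<Rightarrow> 'a \<Rightarrow> 'a \<Rightarrow> real" where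
  "gamma_A df A x x' = ((- df x) \<bullet> (x' - x)) / ((- df x) \<bullet> (s_f df A x - v_f df A x))"

definition mu_A_set :: "('a::real_inner \<Rightarrow> real) \<Rightarrow> ('a \<Rightarrow> 'a) \<Rightarrow> 'a set \<Rightarrow> real set" where
  "mu_A_set f df A = {2 / (gamma_A df A x x')\<^sup>2 * (f x' - f x - (x' - x) \<bullet> df x) | x x'.
      x \<in> convex hull A \<and> x' \<in> convex hull A \<and> df x \<bullet> (x' - x) < 0}"

definition mu_A :: "('a::real_inner \<Rightarrow> real) \<Rightarrow> ('a \<Rightarrow> 'a) \<Rightarrow> 'a set \<Rightarrow> ereal" where
  "mu_A f df A = Inf (ereal ` mu_A_set f df A)"

definition mu_A_L :: "'a::real_inner set \<Rightarrow> 'b::real_inner set \<Rightarrow> 'a set \<Rightarrow> 'b set \<Rightarrow> ('a \<Rightarrow> 'b \<Rightarrow> real)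
    \<Rightarrow> ('a \<Rightarrow> 'b \<Rightarrow> 'a) \<Rightarrow> ('a \<Rightarrow> 'b \<Rightarrow> 'b) \<Rightarrow> ereal" where
  "mu_A_L X Y A B L Gx Gy =
     min (INF y\<in>Y. mu_A (\<lambda>x. L x y) (\<lambda>x. Gx x y) A)
         (INF x\<in>X. mu_A (\<lambda>y. - L x y) (\<lambda>y. - Gy x y) B)"

definition M_XY_set :: "'a::real_inner set \<Rightarrow> 'b set \<Rightarrow> ('a \<Rightarrow> 'b \<Rightarrow> real) \<Rightarrow> ('a \<Rightarrow> 'b \<Rightarrow> 'a)
    \<Rightarrow> 'a \<Rightarrow> 'b \<Rightarrow> real set" where
  "M_XY_set X Y L Gx xs ys = {(s - v) \<bullet> ((1 / sqrt (L xs ys - L xs y)) *\<^sub>R (Gx x ys - Gx x y)) | x y s v.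
      y \<in> Y \<and> y \<noteq> ys \<and> x \<in> X \<and> s \<in> X \<and> v \<in> X}"

definition M_YX_set :: "'a set \<Rightarrow> 'b::real_inner set \<Rightarrow> ('a \<Rightarrow> 'b \<Rightarrow> real) \<Rightarrow> ('a \<Rightarrow> 'b \<Rightarrow> 'b)
    \<Rightarrow> 'a \<Rightarrow> 'b \<Rightarrow> real set" where
  "M_YX_set X Y L Gy xs ys = {(s - v) \<bullet> ((1 / sqrt (L x ys - L xs ys)) *\<^sub>R (Gy x y - Gy xs y)) | x y s v.
      x \<in> X \<and> x \<noteq> xs \<and> y \<in> Y \<and> s \<in> Y \<and> v \<in> Y}"

definition M_L :: "'a::real_inner set \<Rightarrow> 'b::real_inner set \<Rightarrow> ('a \<Rightarrow> 'b \<Rightarrow> real)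
    \<Rightarrow> ('a \<Rightarrow> 'b \<Rightarrow> 'a) \<Rightarrow> ('a \<Rightarrow> 'b \<Rightarrow> 'b) \<Rightarrow> 'a \<Rightarrow> 'b \<Rightarrow> ereal" where
  "M_L X Y L Gx Gy xs ys = max (Sup (ereal ` M_XY_set X Y L Gx xs ys)) (Sup (ereal ` M_YX_set X Y L Gy xs ys))"

definition y_hat :: "'b set \<Rightarrow> ('a \<Rightarrow> 'b \<Rightarrow> real) \<Rightarrow> 'a \<Rightarrow> 'b" where
  "y_hat Y L x = (SOME y. y \<in> Y \<and> (\<forall>y'\<in>Y. L x y' \<le> L x y))"

definition x_hat :: "'a set \<Rightarrow> ('a \<Rightarrow> 'b \<Rightarrow> real) \<Rightarrow> 'b \<Rightarrow> 'a" where
  "x_hat X L y = (SOME x. x \<in> X \<and> (\<forall>x'\<in>X. L x y \<le> L x' y))"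

definition P_X_set :: "'a::real_inner set \<Rightarrow> 'b set \<Rightarrow> ('a \<Rightarrow> 'b \<Rightarrow> real) \<Rightarrow> ('a \<Rightarrow> 'b \<Rightarrow> 'a)
    \<Rightarrow> 'a \<Rightarrow> 'b \<Rightarrow> real set" where
  "P_X_set X Y L Gx xs ys = {(Gx x (y_hat Y L x) \<bullet> (x - xs)) / sqrt (L x ys - L xs ys) | x.
      x \<in> X \<and> x \<noteq> xs}"

definition P_Y_set :: "'a set \<Rightarrow> 'b::real_inner set \<Rightarrow> ('a \<Rightarrow> 'b \<Rightarrow> real) \<Rightarrow> ('a \<Rightarrow> 'b \<Rightarrow> 'b)
    \<Rightarrow> 'a \<Rightarrow> 'b \<Rightarrow> real set" where
  "P_Y_set X Y L Gy xs ys = {(Gy (x_hat X L y) y \<bullet> (ys - y)) / sqrt (L xs ys - L xs y) | y.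
      y \<in> Y \<and> y \<noteq> ys}"

definition P_L :: "'a::real_inner set \<Rightarrow> 'b::real_inner set \<Rightarrow> ('a \<Rightarrow> 'b \<Rightarrow> real)
    \<Rightarrow> ('a \<Rightarrow> 'b \<Rightarrow> 'a) \<Rightarrow> ('a \<Rightarrow> 'b \<Rightarrow> 'b) \<Rightarrow> 'a \<Rightarrow> 'b \<Rightarrow> ereal" where
  "P_L X Y L Gx Gy xs ys = max (Sup (ereal ` P_X_set X Y L Gx xs ys)) (Sup (ereal ` P_Y_set X Y L Gy xs ys))"

definition hgap :: "'a set \<Rightarrow> 'b set \<Rightarrow> ('a \<Rightarrow> 'b \<Rightarrow> real) \<Rightarrow> 'a \<Rightarrow> 'b \<Rightarrow> real" where
  "hgap X Y L x y = (SUP y'\<in>Y. L x y') - (INF x'\<in>X. L x' y)"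

definition wgap :: "('a \<Rightarrow> 'b \<Rightarrow> real) \<Rightarrow> 'a \<Rightarrow> 'b \<Rightarrow> 'a \<Rightarrow> 'b \<Rightarrow> real" where
  "wgap L xs ys x y = L x ys - L xs y"

definition nu_FW :: "'a::euclidean_space set \<Rightarrow> 'b::euclidean_space set \<Rightarrow> ('a \<Rightarrow> 'b \<Rightarrow> real)
    \<Rightarrow> ('a \<Rightarrow> 'b \<Rightarrow> 'a) \<Rightarrow> ('a \<Rightarrow> 'b \<Rightarrow> 'b) \<Rightarrow> 'a \<Rightarrow> 'b \<Rightarrow> ereal" where
  "nu_FW X Y L Gx Gy xs ys =
     1 - M_L X Y L Gx Gy xs ys / ereal (sqrt (real_of_ereal (mu_int_L X Y L Gx Gy xs ys)))"

definition nu_PFW :: "'a::real_inner set \<Rightarrow> 'b::real_inner set \<Rightarrow> 'a set \<Rightarrow> 'b set \<Rightarrow> ('a \<Rightarrow> 'b \<Rightarrow> real)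
    \<Rightarrow> ('a \<Rightarrow> 'b \<Rightarrow> 'a) \<Rightarrow> ('a \<Rightarrow> 'b \<Rightarrow> 'b) \<Rightarrow> 'a \<Rightarrow> 'b \<Rightarrow> ereal" where
  "nu_PFW X Y A B L Gx Gy xs ys =
     ereal (1/2) - M_L X Y L Gx Gy xs ys / ereal (sqrt (real_of_ereal (mu_A_L X Y A B L Gx Gy)))"

definition spfw_run :: "'a::real_inner set \<Rightarrow> 'b::real_inner set \<Rightarrow> ('a \<Rightarrow> 'b \<Rightarrow> 'a) \<Rightarrow> ('a \<Rightarrow> 'b \<Rightarrow> 'b)
    \<Rightarrow> real \<Rightarrow> (nat \<Rightarrow> 'a) \<Rightarrow> (nat \<Rightarrow> 'b) \<Rightarrow> (nat \<Rightarrow> real) \<Rightarrow> bool" where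
  "spfw_run X Y Gx Gy \<eta> x y g \<longleftrightarrow> x 0 \<in> X \<and> y 0 \<in> Y \<and>
     (\<forall>t. let rx = Gx (x t) (y t); ry = - Gy (x t) (y t) in
        \<exists>sx sy \<gamma>. sx \<in> X \<and> sy \<in> Y \<and>
          (\<forall>u\<in>X. rx \<bullet> sx \<le> rx \<bullet> u) \<and> (\<forall>u\<in>Y. ry \<bullet> sy \<le> ry \<bullet> u) \<and>
          g t = (x t - sx) \<bullet> rx + (y t - sy) \<bullet> ry \<and>
          \<gamma> = min 1 (\<eta> * g t) \<and>
          x (Suc t) = (1 - \<gamma>) *\<^sub>R x t + \<gamma> *\<^sub>R sx \<and>
          y (Suc t) = (1 - \<gamma>) *\<^sub>R y t + \<gamma> *\<^sub>R sy)"

text \<open>Maximal away step size min(a/(1-a), b/(1-b)), where a block whose away weight is 1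
  (so that the away direction vanishes in that block) imposes no constraint.\<close>
definition away_max :: "real \<Rightarrow> real \<Rightarrow> real" where
  "away_max a b = (if a = 1 then b / (1 - b) else if b = 1 then a / (1 - a)
                   else min (a / (1 - a)) (b / (1 - b)))"

definition spafw_run :: "'a::real_inner set \<Rightarrow> 'b::real_inner set \<Rightarrow> ('a \<Rightarrow> 'b \<Rightarrow> 'a) \<Rightarrow> ('a \<Rightarrow> 'b \<Rightarrow> 'b)
    \<Rightarrow> real \<Rightarrow> (nat \<Rightarrow> 'a) \<Rightarrow> (nat \<Rightarrow> 'b) \<Rightarrow> (nat \<Rightarrow> 'a \<Rightarrow> real) \<Rightarrow> (nat \<Rightarrow> 'b \<Rightarrow> real)
    \<Rightarrow> (nat \<Rightarrow> real) \<Rightarrow> (nat \<Rightarrow> bool) \<Rightarrow> bool" where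
  "spafw_run A B Gx Gy \<eta> x y ax ay g isdrop \<longleftrightarrow>
     x 0 \<in> A \<and> y 0 \<in> B \<and>
     ax 0 = (\<lambda>v. if v = x 0 then 1 else 0) \<and> ay 0 = (\<lambda>v. if v = y 0 then 1 else 0) \<and>
     (\<forall>t. let rx = Gx (x t) (y t); ry = - Gy (x t) (y t);
              Sx = {v\<in>A. 0 < ax t v}; Sy = {v\<in>B. 0 < ay t v} in
        \<exists>sx sy vx vy \<gamma>. sx \<in> A \<and> sy \<in> B \<and>
          (\<forall>u\<in>A. rx \<bullet> sx \<le> rx \<bullet> u) \<and> (\<forall>u\<in>B. ry \<bullet> sy \<le> ry \<bullet> u) \<and>
          vx \<in> Sx \<and> vy \<in> Sy \<and>
          (\<forall>u\<in>Sx. rx \<bullet> u \<le> rx \<bullet> vx) \<and> (\<forall>u\<in>Sy. ry \<bullet> u \<le> ry \<bullet> vy) \<and>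
          (let fw = - (rx \<bullet> (sx - x t) + ry \<bullet> (sy - y t));
               aw = - (rx \<bullet> (x t - vx) + ry \<bullet> (y t - vy)) in
           g t = fw + aw \<and>
           (if aw \<le> fw then
              \<gamma> = min 1 (\<eta> * g t) \<and>
              x (Suc t) = x t + \<gamma> *\<^sub>R (sx - x t) \<and> y (Suc t) = y t + \<gamma> *\<^sub>R (sy - y t) \<and>
              ax (Suc t) = (\<lambda>v. (1 - \<gamma>) * ax t v + (if v = sx then \<gamma> else 0)) \<and>
              ay (Suc t) = (\<lambda>v. (1 - \<gamma>) * ay t v + (if v = sy then \<gamma> else 0)) \<and>
              \<not> isdrop t
            else
              \<gamma> = min (away_max (ax t vx) (ay t vy)) (\<eta> * g t) \<and>
              x (Suc t) = x t + \<gamma> *\<^sub>R (x t - vx) \<and> y (Suc t) = y t + \<gamma> *\<^sub>R (y t - vy) \<and>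
              ax (Suc t) = (\<lambda>v. (1 + \<gamma>) * ax t v - (if v = vx then \<gamma> else 0)) \<and>
              ay (Suc t) = (\<lambda>v. (1 + \<gamma>) * ay t v - (if v = vy then \<gamma> else 0)) \<and>
              (isdrop t \<longleftrightarrow> \<gamma> = away_max (ax t vx) (ay t vy)))))"

end

theory Submission
  imports Defs
begin

text \<open>Let \<open>w\<close> be the suboptimality \<open>L(x,y\<^sup>*) - L(x\<^sup>*,y)\<close>. The curvature bound, applied to
  \<open>L(\<cdot>,y\<^sup>*)\<close> and \<open>- L(x\<^sup>*,\<cdot>)\<close>, controls one step of length \<open>\<delta>\<close>; replacing the gradients at
  the saddle point by those at the iterate costs at most \<open>M \<surd>(2w)\<close>, and both notions of strong
  convexity give, block by block, \<open>w \<le> \<beta> g - \<beta>\<^sup>2 \<mu> / 2\<close> for some \<open>\<beta>\<close> in \<open>[0,1]\<close>, hence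
  \<open>\<surd>(2w) \<le> g / \<surd>\<mu>\<close>. Together, \<open>w' \<le> w - \<delta> \<nu> g + \<delta>\<^sup>2 C\<close>, and the prescribed step length turns
  this into \<open>w' \<le> (1 - \<rho>) w\<close> and a bound of \<open>g\<close> by \<open>w\<close> on non-drop steps. When the last step is a
  drop step, \<open>g\<close> is only controlled at the previous non-drop step, one factor \<open>1 - \<rho>\<close> too early;
  this factor is recovered from the first step of SP-AFW. The case that \<open>X\<close> and \<open>Y\<close> are both
  singletons is separate, since the constants are then infinite or junk.\<close>

section \<open>Strong convexity constants of a single function\<close>

text \<open>Two inequalities between the constants carry the recursion although the theorem does not
  assume them: \<open>\<mu> \<le> 2 * C\<close> and \<open>\<nu> \<le> \<theta>\<close>, where
  \<theta> is 1 for SP-FW and 1/2 for SP-AFW. They keep 1 - \<rho> in [0,1] and let a full step of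
  length 1 contract as well as a short one. The first follows once some quotient in the set defining
  the strong convexity constant is also a curvature quotient; such a common element is built in both
  cases, and it shows at the same time that the constant is finite. The second is
  \<open>0 \<le> M\<close>, which holds because s - v may vanish. The number \<theta> is the share
  of the gap g that the chosen direction surely realises as slope: all of it for a Frank-Wolfe
  direction, half of it for the better one of two directions. The off-by-one in the bound on the
  smallest gap: k(T) counts the good steps before T. If step T is a drop step and t is the last good
  step before it, then k(T) = k(t) + 1, while g at t is bounded through w at t only. Hence w needs
  one spare factor 1 - \<rho> at every time after 0.\<close>

lemma curv_setI:
  assumes "x \<in> K" "s \<in> K" "v \<in> K" "0 < \<gamma>" "x + \<gamma> *\<^sub>R (s - v) \<in> K"
  shows "2 / \<gamma>\<^sup>2 * (f (x + \<gamma> *\<^sub>R (s - v)) - f x - \<gamma> * ((s - v) \<bullet> df x)) \<in> curv_set f df K"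
  unfolding curv_set_def using assms by blast

text \<open>The derivative is known within K only, so it is tested along the segment to x':
  convexity bounds every difference quotient by \<open>f x' - f x\<close>, and the limit at 0
  inherits the bound.\<close>

lemma strongly_convex_first_order:
  fixes f :: "'a::euclidean_space \<Rightarrow> real"
  assumes K: "convex K" "strongly_convex_on K \<mu> f" "0 < \<mu>"
    and der: "(f has_derivative (\<lambda>h. df \<bullet> h)) (at x within K)"
    and x: "x \<in> K" "x' \<in> K"
  shows "df \<bullet> (x' - x) \<le> f x' - f x"
proof -
  have "((\<lambda>t::real. x + t *\<^sub>R (x' - x)) has_derivative (\<lambda>t. t *\<^sub>R (x' - x))) (at 0 within {0..1})"
    by (auto intro!: derivative_eq_intros)
  moreover have "(\<lambda>t::real. x + t *\<^sub>R (x' - x)) ` {0..1} \<subseteq> K"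
  proof clarify
    fix t :: real assume "t \<in> {0..1}"
    then have "(1 - t) *\<^sub>R x + t *\<^sub>R x' \<in> K"
      using K(1) x by (intro convexD) auto
    then show "x + t *\<^sub>R (x' - x) \<in> K"
      by (simp add: algebra_simps)
  qed
  ultimately have "((f \<circ> (\<lambda>t::real. x + t *\<^sub>R (x' - x))) has_derivative
      ((\<lambda>h. df \<bullet> h) \<circ> (\<lambda>t. t *\<^sub>R (x' - x)))) (at 0 within {0..1})"
    using der by (intro diff_chain_within) (auto intro: has_derivative_subset)
  then have "((\<lambda>t. f (x + t *\<^sub>R (x' - x))) has_field_derivative (df \<bullet> (x' - x))) (at 0 within {0..1})"
    by (simp add: has_field_derivative_def o_def mult_commute_abs)
  then have lim: "((\<lambda>t. (f (x + t *\<^sub>R (x' - x)) - f x) / t) \<longlongrightarrow> df \<bullet> (x' - x)) (at 0 within {0..1})"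
    by (simp add: has_field_derivative_iff)
  show ?thesis
  proof (rule tendsto_upperbound[OF lim])
    show "\<forall>\<^sub>F t in at 0 within {0..1}. (f (x + t *\<^sub>R (x' - x)) - f x) / t \<le> f x' - f x"
      unfolding eventually_at_filter
    proof (intro always_eventually allI impI)
      fix t :: real assume t: "t \<noteq> 0" "t \<in> {0..1}"
      have pt: "t *\<^sub>R x' + (1 - t) *\<^sub>R x = x + t *\<^sub>R (x' - x)"
        by (simp add: algebra_simps)
      have "f (x + t *\<^sub>R (x' - x)) \<le> t * f x' + (1 - t) * f x - \<mu> / 2 * t * (1 - t) * (norm (x' - x))\<^sup>2"
        using K(2) x t unfolding strongly_convex_on_def pt[symmetric] by auto
      moreover have "0 \<le> \<mu> / 2 * t * (1 - t) * (norm (x' - x))\<^sup>2"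
        using K(3) t by auto
      ultimately have "f (x + t *\<^sub>R (x' - x)) \<le> t * f x' + (1 - t) * f x"
        by linarith
      then have "f (x + t *\<^sub>R (x' - x)) - f x \<le> t * (f x' - f x)"
        by (simp add: algebra_simps)
      with t show "(f (x + t *\<^sub>R (x' - x)) - f x) / t \<le> f x' - f x"
        by (simp add: field_simps)
    qed
    show "at (0::real) within {0..1} \<noteq> bot"
      by (simp add: at_within_Icc_at_right)
  qed
qed

text \<open>Compare both values with the one at the midpoint. The strictness is what later makes the
  square roots in the denominators of M and P positive.\<close>

lemma strongly_convex_unique_min:
  assumes K: "convex K" "strongly_convex_on K \<mu> f" "0 < \<mu>"
    and x: "x \<in> K" "u \<in> K" "x \<noteq> u" "\<And>z. z \<in> K \<Longrightarrow> f u \<le> f z"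
  shows "f u < f x"
proof -
  have "f ((1/2) *\<^sub>R x + (1 - 1/2) *\<^sub>R u) \<le> (1/2) * f x + (1 - 1/2) * f u - \<mu> / 2 * (1/2) * (1 - 1/2) * (norm (x - u))\<^sup>2"
    using K(2) x(1,2) unfolding strongly_convex_on_def by (elim ballE allE[of _ "1/2"]) auto
  moreover have "f u \<le> f ((1/2) *\<^sub>R x + (1 - 1/2) *\<^sub>R u)"
    using x K(1) by (intro x(4) convexD) auto
  moreover have "0 < \<mu> * (norm (x - u))\<^sup>2"
    using K(3) x(3) by auto
  ultimately show ?thesis by simp
qed

section \<open>Interior strong convexity\<close>

lemma opposite_frontier_point:
  fixes x xc :: "'a::euclidean_space"
  assumes K: "bounded K" "xc \<in> rel_interior K" "x \<in> K" "x \<noteq> xc"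
  obtains s l where "s \<in> rel_frontier K" "1 \<le> l" "s = x + l *\<^sub>R (xc - x)"
proof -
  have xc: "xc \<in> K"
    using K(2) rel_interior_subset by blast
  \<comment> \<open>The reflection of x through xc lies in the affine hull, so the ray from xc away
    from x has to leave K through its relative frontier.\<close>
  have "2 *\<^sub>R xc + (-1) *\<^sub>R x \<in> affine hull K"
    using K(3) xc by (intro mem_affine) (auto simp: hull_inc)
  then have "xc + (xc - x) \<in> affine hull K"
    by (simp add: algebra_simps scaleR_2)
  then obtain d where "0 < d" "xc + d *\<^sub>R (xc - x) \<in> rel_frontier K"
    using ray_to_rel_frontier[OF K(1,2)] K(4) by (metis eq_iff_diff_eq_0)
  then show ?thesis
    by (intro that[of "xc + d *\<^sub>R (xc - x)" "1 + d"]) (auto simp: algebra_simps)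
qed

text \<open>The point xc sits at fraction \<beta> = 1/l of the segment from x to the opposite
  frontier point s', so the infimum defining the constant may be tested with u = xc. This gives the
  claim with s' in place of s, and the linear minimiser s can only enlarge the slope.\<close>

lemma mu_int_gap:
  fixes f :: "'a::euclidean_space \<Rightarrow> real"
  assumes K: "compact K" "xc \<in> rel_interior K" "x \<in> K"
    and c: "\<And>e. e \<in> mu_int_set f df K xc \<Longrightarrow> c \<le> e"
    and s: "\<And>u. u \<in> K \<Longrightarrow> df x \<bullet> s \<le> df x \<bullet> u"
  shows "\<exists>\<beta>. 0 \<le> \<beta> \<and> \<beta> \<le> 1 \<and> f x - f xc \<le> \<beta> * (df x \<bullet> (x - s)) - \<beta>\<^sup>2 * c / 2"
proof (cases "x = xc")
  case True
  then show ?thesis by (intro exI[of _ 0]) auto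
next
  case False
  obtain s' l where s': "s' \<in> rel_frontier K" "1 \<le> l" "s' = x + l *\<^sub>R (xc - x)"
    using opposite_frontier_point K compact_imp_bounded False by metis
  define \<beta> where "\<beta> = 1 / l"
  have \<beta>: "0 < \<beta>" "\<beta> \<le> 1" and xc: "xc = x + \<beta> *\<^sub>R (s' - x)"
    using s' by (auto simp: \<beta>_def)
  have "2 / \<beta>\<^sup>2 * (f xc - f x - (xc - x) \<bullet> df x) \<in> mu_int_set f df K xc"
    unfolding mu_int_set_def using K(3) False \<beta> s' xc by blast
  then have "c \<le> 2 / \<beta>\<^sup>2 * (f xc - f x - (xc - x) \<bullet> df x)"
    by (rule c)
  then have "\<beta>\<^sup>2 * c / 2 \<le> f xc - f x - (xc - x) \<bullet> df x"
    using \<beta> by (simp add: field_simps)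
  moreover have "s' \<in> K"
    using s'(1) K(1) by (auto simp: rel_frontier_def compact_imp_closed)
  then have "df x \<bullet> (x - s') \<le> df x \<bullet> (x - s)"
    using s by (simp add: inner_diff_right)
  then have "\<beta> * (df x \<bullet> (x - s')) \<le> \<beta> * (df x \<bullet> (x - s))"
    using \<beta> by (intro mult_left_mono) auto
  moreover have "(xc - x) \<bullet> df x = - (\<beta> * (df x \<bullet> (x - s')))"
    by (subst xc) (simp add: inner_commute[of _ "df x"] inner_diff_right algebra_simps)
  ultimately show ?thesis
    using \<beta> by (intro exI[of _ \<beta>] conjI) linarith+
qed

text \<open>With \<gamma> = 1 the test point u is the frontier point s itself, and the quotient is
  the curvature quotient for s and v = x.\<close>

lemma mu_int_set_meets_curv_set:
  fixes f :: "'a::euclidean_space \<Rightarrow> real"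
  assumes K: "compact K" "convex K" "xc \<in> rel_interior K" "K \<noteq> {xc}"
  obtains e where "e \<in> mu_int_set f df K xc" "e \<in> curv_set f df K"
proof -
  have "xc \<in> K"
    using K(3) rel_interior_subset by blast
  with K(4) obtain x where x: "x \<in> K" "x \<noteq> xc" by blast
  obtain s l where s: "s \<in> rel_frontier K" "1 \<le> l" "s = x + l *\<^sub>R (xc - x)"
    using opposite_frontier_point K compact_imp_bounded x by metis
  have sK: "s \<in> K"
    using s(1) K(1) by (auto simp: rel_frontier_def compact_imp_closed)
  define e where "e = 2 / (1::real)\<^sup>2 * (f (x + 1 *\<^sub>R (s - x)) - f x - 1 * ((s - x) \<bullet> df x))"
  have "e \<in> curv_set f df K"
    unfolding e_def using x sK by (intro curv_setI) auto
  moreover have "e = 2 / (1::real)\<^sup>2 * (f (x + 1 *\<^sub>R (s - x)) - f x - (x + 1 *\<^sub>R (s - x) - x) \<bullet> df x)"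
    by (simp add: e_def)
  then have "e \<in> mu_int_set f df K xc"
    unfolding mu_int_set_def using x s zero_less_one order_refl by blast
  ultimately show ?thesis using that by blast
qed

section \<open>Geometric strong convexity on polytopes\<close>

lemma v_S_max:
  assumes "finite A" "S \<in> conv_reps A x"
  shows "v_S df x S \<in> S" "\<And>u. u \<in> S \<Longrightarrow> df x \<bullet> u \<le> df x \<bullet> v_S df x S"
proof -
  have S: "finite S" "S \<noteq> {}"
    using assms finite_subset unfolding conv_reps_def by fastforce+
  obtain v where "v \<in> S" "\<And>u. u \<in> S \<Longrightarrow> df x \<bullet> u \<le> df x \<bullet> v"
    using S ex_is_arg_min_if_finite[of S "\<lambda>v. - (df x \<bullet> v)"]
    by (auto simp: is_arg_min_linorder)
  then have "\<exists>v. v \<in> S \<and> (\<forall>u\<in>S. df x \<bullet> u \<le> df x \<bullet> v)" by blast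
  then have "v_S df x S \<in> S \<and> (\<forall>u\<in>S. df x \<bullet> u \<le> df x \<bullet> v_S df x S)"
    unfolding v_S_def by (rule someI_ex)
  then show "v_S df x S \<in> S" "\<And>u. u \<in> S \<Longrightarrow> df x \<bullet> u \<le> df x \<bullet> v_S df x S" by auto
qed

lemma v_f_min:
  assumes "finite A" "conv_reps A x \<noteq> {}"
  obtains S where "S \<in> conv_reps A x" "v_f df A x = v_S df x S"
    "\<And>S'. S' \<in> conv_reps A x \<Longrightarrow> df x \<bullet> v_f df A x \<le> df x \<bullet> v_S df x S'"
proof -
  have "conv_reps A x \<subseteq> Pow A"
    unfolding conv_reps_def by auto
  then have "finite (conv_reps A x)"
    using assms(1) finite_subset by blast
  then obtain S where "S \<in> conv_reps A x" "\<And>S'. S' \<in> conv_reps A x \<Longrightarrow> df x \<bullet> v_S df x S \<le> df x \<bullet> v_S df x S'"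
    using assms(2) ex_is_arg_min_if_finite[of "conv_reps A x" "\<lambda>S. df x \<bullet> v_S df x S"]
    by (auto simp: is_arg_min_linorder)
  then have "\<exists>v. v \<in> {v_S df x S | S. S \<in> conv_reps A x} \<and>
      (\<forall>S\<in>conv_reps A x. df x \<bullet> v \<le> df x \<bullet> v_S df x S)" by blast
  then have "v_f df A x \<in> {v_S df x S | S. S \<in> conv_reps A x} \<and>
      (\<forall>S\<in>conv_reps A x. df x \<bullet> v_f df A x \<le> df x \<bullet> v_S df x S)"
    unfolding v_f_def by (rule someI_ex)
  then show ?thesis using that by blast
qed

lemma s_f_min:
  assumes "finite A" "A \<noteq> {}"
  shows "s_f df A x \<in> A" "\<And>u. u \<in> A \<Longrightarrow> df x \<bullet> s_f df A x \<le> df x \<bullet> u"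
proof -
  have "\<exists>v. v \<in> A \<and> (\<forall>u\<in>A. df x \<bullet> v \<le> df x \<bullet> u)"
    using assms ex_is_arg_min_if_finite[of A "\<lambda>v. df x \<bullet> v"]
    by (auto simp: is_arg_min_linorder)
  then have "s_f df A x \<in> A \<and> (\<forall>u\<in>A. df x \<bullet> s_f df A x \<le> df x \<bullet> u)"
    unfolding s_f_def by (rule someI_ex)
  then show "s_f df A x \<in> A" "\<And>u. u \<in> A \<Longrightarrow> df x \<bullet> s_f df A x \<le> df x \<bullet> u" by auto
qed

lemma inner_ge_on_convex_hull:
  fixes r :: "'a::real_inner"
  assumes "\<And>u. u \<in> A \<Longrightarrow> m \<le> r \<bullet> u" "z \<in> convex hull A"
  shows "m \<le> r \<bullet> z"
proof -
  have "convex hull A \<subseteq> {z. m \<le> r \<bullet> z}"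
    using assms(1) by (intro hull_minimal) (auto simp: convex_halfspace_ge)
  then show ?thesis using assms(2) by auto
qed

lemma conv_reps_subset_hull:
  assumes "finite A" "S \<in> conv_reps A x"
  shows "x \<in> convex hull S" "finite S" "S \<subseteq> A"
proof -
  show S: "finite S" "S \<subseteq> A"
    using assms finite_subset unfolding conv_reps_def by auto
  show "x \<in> convex hull S"
    using assms(2) less_imp_le unfolding conv_reps_def convex_hull_finite[OF S(1)]
    by (smt (verit, best) mem_Collect_eq)
qed

lemma conv_reps_nonempty:
  assumes "finite A" "x \<in> convex hull A"
  shows "conv_reps A x \<noteq> {}"
proof -
  obtain c where c: "\<forall>v\<in>A. 0 \<le> c v" "sum c A = 1" "(\<Sum>v\<in>A. c v *\<^sub>R v) = x"
    using assms convex_hull_finite[OF assms(1)] by auto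
  have "sum c {v\<in>A. 0 < c v} = 1" "(\<Sum>v\<in>{v\<in>A. 0 < c v}. c v *\<^sub>R v) = x"
    using c(1) by (subst c(2,3)[symmetric]; intro sum.mono_neutral_left; use assms(1) in force)+
  then have "{v\<in>A. 0 < c v} \<in> conv_reps A x"
    unfolding conv_reps_def by (auto intro!: exI[of _ c])
  then show ?thesis by blast
qed

text \<open>The infimum is tested at the given x', with \<beta> the value of \<open>gamma_A\<close>.
  As \<open>v_f\<close> is the least favourable away vertex over all representations of x, the
  pairwise gap of the actual active set S is at least the denominator of \<open>gamma_A\<close>. If
  x' is not in a descent direction, the first-order inequality already gives
  \<open>f x \<le> f x'\<close> and \<beta> = 0 serves.\<close>

lemma mu_A_gap:
  fixes f :: "'a::euclidean_space \<Rightarrow> real"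
  assumes A: "finite A" "S \<in> conv_reps A x" "x' \<in> convex hull A"
    and fo: "df x \<bullet> (x' - x) \<le> f x' - f x"
    and c: "\<And>e. e \<in> mu_A_set f df A \<Longrightarrow> c \<le> e"
    and s: "s \<in> A" "\<And>u. u \<in> A \<Longrightarrow> df x \<bullet> s \<le> df x \<bullet> u"
    and v: "v \<in> S" "\<And>u. u \<in> S \<Longrightarrow> df x \<bullet> u \<le> df x \<bullet> v"
  shows "\<exists>\<beta>. 0 \<le> \<beta> \<and> \<beta> \<le> 1 \<and> f x - f x' \<le> \<beta> * (df x \<bullet> (v - s)) - \<beta>\<^sup>2 * c / 2"
proof (cases "df x \<bullet> (x' - x) < 0")
  case False
  then show ?thesis using fo by (intro exI[of _ 0]) auto
next
  case True
  have x: "x \<in> convex hull A"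
    using conv_reps_subset_hull[OF A(1,2)] hull_mono by blast
  obtain S' where S': "S' \<in> conv_reps A x" "v_f df A x = v_S df x S'"
    "\<And>S''. S'' \<in> conv_reps A x \<Longrightarrow> df x \<bullet> v_f df A x \<le> df x \<bullet> v_S df x S''"
    using v_f_min A(1,2) by (metis empty_iff)
  have sf: "df x \<bullet> s_f df A x = df x \<bullet> s"
    using s s_f_min[OF A(1), where df = df and x = x] by (metis empty_iff order_antisym)
  have "df x \<bullet> v_f df A x \<le> df x \<bullet> v_S df x S"
    using S'(3) A(2) by auto
  also have "\<dots> \<le> df x \<bullet> v"
    using v_S_max(1)[OF A(1,2)] v(2) by auto
  finally have vf: "df x \<bullet> v_f df A x \<le> df x \<bullet> v" .
  \<comment> \<open>Since x is a combination of atoms scoring at most as high as \<open>v_f\<close>,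
    and x' one of atoms scoring at least as high as s, the numerator of \<open>gamma_A\<close> is at
    most its denominator; this is \<beta> \<le> 1.\<close>
  have "- (df x \<bullet> v_f df A x) \<le> (- df x) \<bullet> x"
    using v_S_max(2)[OF A(1) S'(1)] S'(2)
    by (intro inner_ge_on_convex_hull[OF _ conv_reps_subset_hull(1)[OF A(1) S'(1)]]) auto
  moreover have "df x \<bullet> s \<le> df x \<bullet> x'"
    using s by (intro inner_ge_on_convex_hull[OF _ A(3)]) auto
  ultimately have ord: "df x \<bullet> s \<le> df x \<bullet> x'" "df x \<bullet> x \<le> df x \<bullet> v_f df A x" by auto
  define G where "G = df x \<bullet> v_f df A x - df x \<bullet> s"
  define \<beta> where "\<beta> = gamma_A df A x x'"
  have num: "df x \<bullet> x - df x \<bullet> x' \<le> G" "0 < df x \<bullet> x - df x \<bullet> x'"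
    using ord True by (auto simp: G_def inner_diff_right)
  have \<beta>': "\<beta> = (df x \<bullet> x - df x \<bullet> x') / G"
    unfolding \<beta>_def gamma_A_def G_def by (simp add: inner_diff_right sf)
  have \<beta>: "0 < \<beta>" "\<beta> \<le> 1" "\<beta> * G = df x \<bullet> x - df x \<bullet> x'"
    using num by (auto simp: \<beta>' field_simps)
  have "c \<le> 2 / \<beta>\<^sup>2 * (f x' - f x - (x' - x) \<bullet> df x)"
    unfolding \<beta>_def using x A(3) True by (intro c) (auto simp: mu_A_set_def)
  then have "\<beta>\<^sup>2 * c / 2 \<le> f x' - f x - (x' - x) \<bullet> df x"
    using \<beta> by (simp add: field_simps)
  then have "f x - f x' \<le> \<beta> * G - \<beta>\<^sup>2 * c / 2"
    by (simp add: \<beta>(3) inner_commute[of _ "df x"] inner_diff_right)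
  also have "\<beta> * G \<le> \<beta> * (df x \<bullet> (v - s))"
    using \<beta> vf by (intro mult_left_mono) (auto simp: G_def inner_diff_right)
  finally show ?thesis
    using \<beta> by (intro exI[of _ \<beta>]) auto
qed

text \<open>Shifting a little weight from the away vertex \<open>v_f\<close> to the vertex \<open>s_f\<close> is a
  feasible displacement for which \<open>gamma_A\<close> is the shifted weight.\<close>

lemma mu_A_set_meets_curv_set:
  fixes f :: "'a::euclidean_space \<Rightarrow> real"
  assumes A: "finite A" "x \<in> convex hull A" "x' \<in> convex hull A" "df x \<bullet> (x' - x) < 0"
  obtains e where "e \<in> mu_A_set f df A" "e \<in> curv_set f df (convex hull A)"
proof -
  have ne: "A \<noteq> {}" using A(2) by auto
  note s = s_f_min[OF A(1) ne, where df = df and x = x]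
  obtain S where S: "S \<in> conv_reps A x" "v_f df A x = v_S df x S"
    using v_f_min[OF A(1) conv_reps_nonempty[OF A(1,2)]] by metis
  note Sf = conv_reps_subset_hull[OF A(1) S(1)]
  have vS: "v_f df A x \<in> S"
    using v_S_max(1)[OF A(1) S(1)] S(2) by metis
  have vmax: "\<And>u. u \<in> S \<Longrightarrow> df x \<bullet> u \<le> df x \<bullet> v_f df A x"
    using v_S_max(2)[OF A(1) S(1)] S(2) by metis
  have "- (df x \<bullet> v_f df A x) \<le> (- df x) \<bullet> x"
    using vmax by (intro inner_ge_on_convex_hull[OF _ Sf(1)]) auto
  moreover have "df x \<bullet> s_f df A x \<le> df x \<bullet> x'"
    using s by (intro inner_ge_on_convex_hull[OF _ A(3)]) auto
  ultimately have lt: "df x \<bullet> (s_f df A x - v_f df A x) < 0"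
    using A(4) by (auto simp: inner_diff_right)
  obtain c where c: "\<forall>v\<in>S. 0 < c v" "sum c S = 1" "(\<Sum>v\<in>S. c v *\<^sub>R v) = x"
    using S(1) unfolding conv_reps_def by auto
  \<comment> \<open>Moving the whole weight of \<open>v_f\<close> merely replaces this atom by
    \<open>s_f\<close> in the combination, so feasibility of z is immediate.\<close>
  define \<gamma> where "\<gamma> = c (v_f df A x)"
  define z where "z = x + \<gamma> *\<^sub>R (s_f df A x - v_f df A x)"
  have \<gamma>: "0 < \<gamma>" using c(1) vS by (auto simp: \<gamma>_def)
  have "z = (\<Sum>v\<in>S. c v *\<^sub>R (if v = v_f df A x then s_f df A x else v))"
  proof -
    have "(\<Sum>v\<in>S. c v *\<^sub>R (if v = v_f df A x then s_f df A x else v)) =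
        (\<Sum>v\<in>S. c v *\<^sub>R v) + (\<Sum>v\<in>S. if v = v_f df A x then c v *\<^sub>R (s_f df A x - v_f df A x) else 0)"
      by (subst sum.distrib[symmetric]) (intro sum.cong, auto simp: algebra_simps)
    then show ?thesis
      using vS Sf(2) c(3) by (simp add: z_def \<gamma>_def sum.delta)
  qed
  also have "\<dots> \<in> convex hull A"
    using Sf s(1) c by (intro convex_sum) (auto simp: convex_convex_hull less_imp_le intro!: hull_inc)
  finally have z: "z \<in> convex hull A" .
  have zx: "z - x = \<gamma> *\<^sub>R (s_f df A x - v_f df A x)" by (simp add: z_def)
  have "gamma_A df A x z = \<gamma>"
    using lt by (simp add: gamma_A_def zx)
  moreover have "df x \<bullet> (z - x) < 0"
    using lt \<gamma> by (simp add: zx mult_pos_neg)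
  ultimately have "2 / \<gamma>\<^sup>2 * (f z - f x - (z - x) \<bullet> df x) \<in> mu_A_set f df A"
    unfolding mu_A_set_def using A(2) z by force
  moreover have "2 / \<gamma>\<^sup>2 * (f z - f x - \<gamma> * ((s_f df A x - v_f df A x) \<bullet> df x)) \<in> curv_set f df (convex hull A)"
    unfolding z_def using z[unfolded z_def] A(2) \<gamma> s(1) vS Sf(3)
    by (intro curv_setI) (auto intro!: hull_inc)
  then have "2 / \<gamma>\<^sup>2 * (f z - f x - (z - x) \<bullet> df x) \<in> curv_set f df (convex hull A)"
    by (simp add: zx)
  ultimately show ?thesis using that by blast
qed

section \<open>Real recursions\<close>

text \<open>The larger of the two fractions serves for both blocks: the gaps are nonnegative, so
  enlarging a fraction only raises the linear terms, and the square of the maximum is at most the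
  sum of the squares. Thus \<mu> is not halved.\<close>

lemma gap_add:
  fixes \<mu> :: real
  assumes a: "\<exists>\<beta>. 0 \<le> \<beta> \<and> \<beta> \<le> 1 \<and> wx \<le> \<beta> * gx - \<beta>\<^sup>2 * \<mu> / 2"
    and b: "\<exists>\<beta>. 0 \<le> \<beta> \<and> \<beta> \<le> 1 \<and> wy \<le> \<beta> * gy - \<beta>\<^sup>2 * \<mu> / 2"
    and nn: "0 \<le> gx" "0 \<le> gy" "0 < \<mu>"
  shows "\<exists>\<beta>. 0 \<le> \<beta> \<and> \<beta> \<le> 1 \<and> wx + wy \<le> \<beta> * (gx + gy) - \<beta>\<^sup>2 * \<mu> / 2"
proof -
  obtain p where p: "0 \<le> p" "p \<le> 1" "wx \<le> p * gx - p\<^sup>2 * \<mu> / 2" using a by blast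
  obtain q where q: "0 \<le> q" "q \<le> 1" "wy \<le> q * gy - q\<^sup>2 * \<mu> / 2" using b by blast
  have pq: "0 \<le> p\<^sup>2 * \<mu>" "0 \<le> q\<^sup>2 * \<mu>" using nn by auto
  define m where "m = max p q"
  have m: "0 \<le> m" "m \<le> 1" using p q by (auto simp: m_def)
  have "p * gx \<le> m * gx" "q * gy \<le> m * gy"
    using nn by (auto simp: m_def intro!: mult_right_mono)
  moreover have "m\<^sup>2 * \<mu> \<le> p\<^sup>2 * \<mu> + q\<^sup>2 * \<mu>"
    using pq by (auto simp: m_def max_def)
  moreover have "m * (gx + gy) = m * gx + m * gy"
    by (simp add: distrib_left)
  ultimately show ?thesis
    using p q m by (intro exI[of _ m] conjI) linarith+
qed

text \<open>Completing the square in \<beta>: the worst fraction is g / \<mu>.\<close>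

lemma gap_le_square:
  fixes \<mu> :: real
  assumes "w \<le> \<beta> * g - \<beta>\<^sup>2 * \<mu> / 2" "0 < \<mu>"
  shows "2 * \<mu> * w \<le> g\<^sup>2"
proof -
  have "2 * \<mu> * w \<le> 2 * \<mu> * (\<beta> * g - \<beta>\<^sup>2 * \<mu> / 2)"
    using assms by (intro mult_left_mono) auto
  also have "\<dots> = g\<^sup>2 - (g - \<beta> * \<mu>)\<^sup>2"
    by (simp add: power2_eq_square algebra_simps)
  finally show ?thesis using zero_le_power2[of "g - \<beta> * \<mu>"] by linarith
qed

lemma gap_le:
  fixes \<mu> :: real
  assumes "w \<le> \<beta> * g - \<beta>\<^sup>2 * \<mu> / 2" "0 \<le> \<beta>" "\<beta> \<le> 1" "0 < \<mu>" "0 \<le> g"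
  shows "w \<le> g" and "\<mu> \<le> g \<Longrightarrow> w \<le> g - \<mu> / 2"
proof -
  have "\<beta> * g \<le> 1 * g" using assms by (intro mult_right_mono) auto
  moreover have "0 \<le> \<beta>\<^sup>2 * \<mu> / 2" using assms by auto
  ultimately show "w \<le> g" using assms by linarith
  assume "\<mu> \<le> g"
  \<comment> \<open>For \<mu> \<le> g the bound increases in \<beta> on [0,1], and its distance to
    the value at \<beta> = 1 factors.\<close>
  have "(g - \<mu> / 2) - (\<beta> * g - \<beta>\<^sup>2 * \<mu> / 2) = (1 - \<beta>) * (g - (1 + \<beta>) * \<mu> / 2)"
    by (simp add: power2_eq_square field_simps)
  moreover have "\<beta> * \<mu> \<le> 1 * \<mu>" using assms by (intro mult_right_mono) auto
  then have "0 \<le> g - (1 + \<beta>) * \<mu> / 2" using \<open>\<mu> \<le> g\<close> by (simp add: algebra_simps)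
  then have "0 \<le> (1 - \<beta>) * (g - (1 + \<beta>) * \<mu> / 2)" using assms by auto
  ultimately show "w \<le> g - \<mu> / 2" using assms by linarith
qed

lemma rho_bounds:
  fixes \<mu> :: real
  assumes "0 < \<nu>" "\<nu> \<le> 1" "0 < \<mu>" "\<mu> \<le> 2 * C"
  shows "0 \<le> \<nu>\<^sup>2 * \<mu> / (2 * C)" "\<nu>\<^sup>2 * \<mu> / (2 * C) \<le> \<nu>\<^sup>2" "\<nu>\<^sup>2 * \<mu> / (2 * C) \<le> 1"
proof -
  have "\<nu>\<^sup>2 * (\<mu> / (2 * C)) \<le> \<nu>\<^sup>2 * 1"
    using assms by (intro mult_left_mono) auto
  then show a: "\<nu>\<^sup>2 * \<mu> / (2 * C) \<le> \<nu>\<^sup>2" by simp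
  also have "\<nu>\<^sup>2 \<le> 1" using assms by (simp add: power_le_one)
  finally show "\<nu>\<^sup>2 * \<mu> / (2 * C) \<le> 1" .
  show "0 \<le> \<nu>\<^sup>2 * \<mu> / (2 * C)" using assms by auto
qed

text \<open>The length \<open>\<nu> * g / (2 * C)\<close> is optimal for slope \<nu> g. The slope
  factor \<kappa> is kept separate because the first step of SP-AFW uses this length with a larger
  slope.\<close>

lemma short_step_value:
  fixes C :: real
  assumes "0 < C"
  shows "\<nu> * g / (2 * C) * \<kappa> * g - (\<nu> * g / (2 * C))\<^sup>2 * C = (2 * \<nu> * \<kappa> - \<nu>\<^sup>2) * g\<^sup>2 / (4 * C)"
proof -
  define d where "d = \<nu> * g / (2 * C)"
  have "d * (2 * C) = \<nu> * g" using assms by (simp add: d_def)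
  then have "(d * \<kappa> * g - d\<^sup>2 * C) * (4 * C) = (2 * \<nu> * \<kappa> - \<nu>\<^sup>2) * g\<^sup>2" by algebra
  then show ?thesis using assms by (simp add: d_def[symmetric] eq_divide_eq)
qed

lemma rho_le_short:
  fixes \<mu> :: real
  assumes "2 * \<mu> * w \<le> g\<^sup>2" "0 < C"
  shows "\<nu>\<^sup>2 * \<mu> / (2 * C) * w \<le> \<nu>\<^sup>2 * g\<^sup>2 / (4 * C)"
proof -
  have "\<nu>\<^sup>2 / (4 * C) * (2 * \<mu> * w) \<le> \<nu>\<^sup>2 / (4 * C) * g\<^sup>2"
    using assms by (intro mult_left_mono) auto
  then show ?thesis by (simp add: field_simps)
qed

lemma good_step_decrease:
  fixes \<mu> :: real
  assumes w: "w' \<le> w - \<delta> * \<nu> * g + \<delta>\<^sup>2 * C"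
    and gap: "\<exists>\<beta>. 0 \<le> \<beta> \<and> \<beta> \<le> 1 \<and> w \<le> \<beta> * g - \<beta>\<^sup>2 * \<mu> / 2"
    and \<delta>: "\<delta> = \<nu> * g / (2 * C) \<or> \<delta> = 1 \<and> 2 * C \<le> \<nu> * g"
    and c: "0 < \<nu>" "\<nu> \<le> 1" "0 < \<mu>" "\<mu> \<le> 2 * C" "0 \<le> g"
  shows "w' \<le> (1 - \<nu>\<^sup>2 * \<mu> / (2 * C)) * w"
proof -
  obtain \<beta> where \<beta>: "0 \<le> \<beta>" "\<beta> \<le> 1" "w \<le> \<beta> * g - \<beta>\<^sup>2 * \<mu> / 2" using gap by blast
  have C: "0 < C" using c by linarith
  show ?thesis using \<delta>
  proof
    assume s: "\<delta> = \<nu> * g / (2 * C)"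
    have "\<delta> * \<nu> * g - \<delta>\<^sup>2 * C = \<nu>\<^sup>2 * g\<^sup>2 / (4 * C)"
      unfolding s short_step_value[OF C] by (simp add: power2_eq_square)
    then show ?thesis
      using w rho_le_short[OF gap_le_square[OF \<beta>(3) c(3)] C, of \<nu>] by (simp add: left_diff_distrib)
  next
    assume s: "\<delta> = 1 \<and> 2 * C \<le> \<nu> * g"
    have "\<nu> * g \<le> 1 * g" using c by (intro mult_right_mono) auto
    then have \<mu>g: "\<mu> \<le> g" using s c by linarith
    define \<rho> where "\<rho> = \<nu>\<^sup>2 * \<mu> / (2 * C)"
    have \<rho>: "0 \<le> \<rho>" "\<rho> \<le> \<nu>\<^sup>2" using rho_bounds[OF c(1-4)] by (auto simp: \<rho>_def)
    have "\<rho> * w \<le> \<rho> * (g - \<mu> / 2)"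
      using gap_le(2)[OF \<beta>(3,1,2) c(3,5) \<mu>g] \<rho> by (intro mult_left_mono) auto
    also have "\<rho> * (g - \<mu> / 2) \<le> \<nu> * g - C"
    proof -
      have "0 \<le> (\<nu> - \<rho>) * (g - 2 * C / \<nu>)"
      proof (rule mult_nonneg_nonneg)
        have "\<nu>\<^sup>2 \<le> \<nu>" using c by (simp add: power2_eq_square mult_left_le)
        then show "0 \<le> \<nu> - \<rho>" using \<rho> by linarith
        show "0 \<le> g - 2 * C / \<nu>" using s c by (simp add: field_simps)
      qed
      moreover have "C * (1 - \<rho> / \<nu>)\<^sup>2 \<ge> 0" using C by auto
      \<comment> \<open>Both sides are affine in g and are expanded around the threshold g =
        2C/\<nu> at which full steps begin; by the definition of \<rho> the value there is a
        multiple of a square.\<close>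
      moreover have "\<nu> * g - C - \<rho> * (g - \<mu> / 2) = (\<nu> - \<rho>) * (g - 2 * C / \<nu>) + C * (1 - \<rho> / \<nu>)\<^sup>2"
        using C c unfolding \<rho>_def by (simp add: field_simps power2_eq_square)
      ultimately show ?thesis by linarith
    qed
    finally show ?thesis
      using w s by (simp add: left_diff_distrib \<rho>_def)
  qed
qed

text \<open>The two alternatives stem from a short step and a full step; the maximum in the
  conclusion covers both.\<close>

lemma gap_le_max_sqrt:
  fixes C :: real
  assumes "\<nu>\<^sup>2 * g\<^sup>2 \<le> 4 * C * b \<or> \<nu> * g \<le> 2 * b" "0 < \<nu>" "0 < C" "0 \<le> b"
  shows "g \<le> 2 * max (sqrt C) (sqrt b) / \<nu> * sqrt b"
proof -
  have "\<nu> * g \<le> 2 * max (sqrt C) (sqrt b) * sqrt b"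
    using assms(1)
  proof
    assume "\<nu>\<^sup>2 * g\<^sup>2 \<le> 4 * C * b"
    then have "(\<nu> * g)\<^sup>2 \<le> (2 * sqrt C * sqrt b)\<^sup>2"
      using assms by (simp add: power_mult_distrib)
    then have "\<nu> * g \<le> 2 * sqrt C * sqrt b"
      by (rule power2_le_imp_le) (use assms(2-4) in auto)
    also have "\<dots> \<le> 2 * max (sqrt C) (sqrt b) * sqrt b"
      using assms(2-4) by (intro mult_right_mono) auto
    finally show ?thesis .
  next
    assume "\<nu> * g \<le> 2 * b"
    also have "2 * b = 2 * sqrt b * sqrt b" using assms(4) by simp
    also have "\<dots> \<le> 2 * max (sqrt C) (sqrt b) * sqrt b"
      using assms(2-4) by (intro mult_right_mono) auto
    finally show ?thesis .
  qed
  then show ?thesis using assms(2) by (simp add: pos_le_divide_eq mult.commute)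
qed

text \<open>The new value is still nonnegative, so the guaranteed decrease cannot exceed w. On a
  short step this decrease is quadratic in g, on a full step at least
  \<open>\<nu> * g / 2\<close>.\<close>

lemma good_step_gap:
  fixes C :: real
  assumes w: "0 \<le> w'" "w' \<le> w - \<delta> * \<nu> * g + \<delta>\<^sup>2 * C"
    and \<delta>: "\<delta> = \<nu> * g / (2 * C) \<or> \<delta> = 1 \<and> 2 * C \<le> \<nu> * g"
    and c: "0 < \<nu>" "0 < C" "0 \<le> w"
  shows "g \<le> 2 * max (sqrt C) (sqrt w) / \<nu> * sqrt w"
proof (rule gap_le_max_sqrt)
  show "\<nu>\<^sup>2 * g\<^sup>2 \<le> 4 * C * w \<or> \<nu> * g \<le> 2 * w"
    using \<delta>
  proof
    assume s: "\<delta> = \<nu> * g / (2 * C)"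
    have "\<delta> * \<nu> * g - \<delta>\<^sup>2 * C = \<nu>\<^sup>2 * g\<^sup>2 / (4 * C)"
      unfolding s short_step_value[OF c(2)] by (simp add: power2_eq_square)
    then have "\<nu>\<^sup>2 * g\<^sup>2 / (4 * C) \<le> w" using w by linarith
    then show ?thesis using c by (simp add: field_simps)
  next
    assume s: "\<delta> = 1 \<and> 2 * C \<le> \<nu> * g"
    then show ?thesis using w by auto
  qed
qed (use c in auto)

text \<open>The first step of SP-AFW has no away gap, so the descent constant is \<open>1/2 + \<nu>\<close> instead
  of \<open>\<nu>\<close>. This makes the step worth at least two steps, which is what later compensates for a
  last step that is a drop step.\<close>

lemma first_step:
  fixes \<mu> :: real
  assumes w: "0 \<le> w'" "w' \<le> w - \<delta> * (1/2 + \<nu>) * g + \<delta>\<^sup>2 * C"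
    and gap: "\<exists>\<beta>. 0 \<le> \<beta> \<and> \<beta> \<le> 1 \<and> w \<le> \<beta> * g - \<beta>\<^sup>2 * \<mu> / 2"
    and \<delta>: "\<delta> = \<nu> * g / (2 * C) \<or> \<delta> = 1 \<and> 2 * C \<le> \<nu> * g"
    and c: "0 < \<nu>" "\<nu> \<le> 1/2" "0 < \<mu>" "\<mu> \<le> 2 * C" "0 \<le> g" "0 \<le> w"
  defines "r \<equiv> 1 - \<nu>\<^sup>2 * \<mu> / (2 * C)"
  shows "w' \<le> r\<^sup>2 * w" "g \<le> 2 * max (sqrt C) (sqrt (r * w)) / \<nu> * sqrt (r * w)"
proof -
  obtain \<beta> where \<beta>: "0 \<le> \<beta>" "\<beta> \<le> 1" "w \<le> \<beta> * g - \<beta>\<^sup>2 * \<mu> / 2" using gap by blast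
  have C: "0 < C" using c by linarith
  define \<rho> where "\<rho> = \<nu>\<^sup>2 * \<mu> / (2 * C)"
  have \<nu>2: "\<nu>\<^sup>2 \<le> \<nu> / 2"
    using c by (simp add: power2_eq_square)
  have \<rho>: "0 \<le> \<rho>" "\<rho> \<le> \<nu> / 2" "\<rho> \<le> 1/4"
    using rho_bounds(1,2)[of \<nu> \<mu> C, folded \<rho>_def] c \<nu>2 by linarith+
  have r: "r = 1 - \<rho>" by (simp add: r_def \<rho>_def)
  have "w' \<le> w - 3 * \<rho> * w \<and> (\<nu>\<^sup>2 * g\<^sup>2 \<le> 4 * C * (r * w) \<or> \<nu> * g \<le> 2 * (r * w))"
    using \<delta>
  proof
    assume s: "\<delta> = \<nu> * g / (2 * C)"
    define q where "q = \<nu>\<^sup>2 * g\<^sup>2 / (4 * C)"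
    have q: "\<rho> * w \<le> q"
      unfolding \<rho>_def q_def by (rule rho_le_short[OF gap_le_square[OF \<beta>(3) c(3)] C])
    \<comment> \<open>The larger slope triples the usual decrease q, because \<nu> \<le> 1/2. As w'
      stays nonnegative, q is also at most a third of w, well below r w.\<close>
    have "3 * \<nu>\<^sup>2 \<le> 2 * \<nu> * (1/2 + \<nu>) - \<nu>\<^sup>2"
      using \<nu>2 by (simp add: power2_eq_square algebra_simps)
    then have "3 * \<nu>\<^sup>2 * g\<^sup>2 / (4 * C) \<le> (2 * \<nu> * (1/2 + \<nu>) - \<nu>\<^sup>2) * g\<^sup>2 / (4 * C)"
      using C by (intro divide_right_mono mult_right_mono) auto
    then have "3 * q \<le> \<delta> * (1/2 + \<nu>) * g - \<delta>\<^sup>2 * C"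
      unfolding s short_step_value[OF C] q_def by simp
    then have d: "w' \<le> w - 3 * q" using w by linarith
    have "\<rho> * w \<le> (1/4) * w" using \<rho> c by (intro mult_right_mono) auto
    then have "q \<le> r * w" using d w c by (simp add: r left_diff_distrib)
    then have "\<nu>\<^sup>2 * g\<^sup>2 \<le> 4 * C * (r * w)"
      using C by (simp add: q_def field_simps)
    then show ?thesis using d q by auto
  next
    assume s: "\<delta> = 1 \<and> 2 * C \<le> \<nu> * g"
    \<comment> \<open>On a full step C is at most \<open>\<nu> * g / 2\<close>, which leaves half of
      the \<nu> part of the slope.\<close>
    then have d: "w' \<le> w - g / 2 - \<nu> * g / 2"
      using w by (simp add: algebra_simps)
    have wg: "w \<le> g" using gap_le(1)[OF \<beta>(3,1,2) c(3,5)] .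
    have p: "\<rho> * w \<le> (1/4) * w" using \<rho> c by (intro mult_right_mono) auto
    have p2: "\<rho> * w \<le> (\<nu> / 2) * w" using \<rho> c by (intro mult_right_mono) auto
    have "(\<nu> / 2) * w \<le> (\<nu> / 2) * g" using wg c by (intro mult_left_mono) auto
    then have "w' \<le> w - 3 * \<rho> * w" using d p p2 wg by simp
    moreover have "\<nu> * g \<le> (1/2) * g" using c by (intro mult_right_mono) auto
    then have "\<nu> * g \<le> 2 * (r * w)"
      using d w p c mult_nonneg_nonneg[of \<nu> g] by (simp add: r left_diff_distrib)
    ultimately show ?thesis by auto
  qed
  then have a: "w' \<le> w - 3 * \<rho> * w" and b: "\<nu>\<^sup>2 * g\<^sup>2 \<le> 4 * C * (r * w) \<or> \<nu> * g \<le> 2 * (r * w)"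
    by auto
  \<comment> \<open>Losing the fraction 3\<rho> is more than two contractions, which lose only
    2\<rho> minus the square of \<rho>.\<close>
  have "0 \<le> (\<rho> + \<rho>\<^sup>2) * w" using \<rho> c by auto
  moreover have "r\<^sup>2 * w - (w - 3 * \<rho> * w) = (\<rho> + \<rho>\<^sup>2) * w"
    by (simp add: r power2_eq_square algebra_simps)
  ultimately show "w' \<le> r\<^sup>2 * w" using a by linarith
  show "g \<le> 2 * max (sqrt C) (sqrt (r * w)) / \<nu> * sqrt (r * w)"
    using b c C \<rho> by (intro gap_le_max_sqrt) (auto simp: r)
qed

text \<open>A truncated step is at most as long as the minimiser of the quadratic bound, and on that
  range the bound stays below w.\<close>

lemma drop_step_nonincreasing:
  fixes C :: real
  assumes "w' \<le> w - \<delta> * \<nu> * g + \<delta>\<^sup>2 * C" "0 \<le> \<delta>" "\<delta> \<le> \<nu> * g / (2 * C)" "0 < C"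
  shows "w' \<le> w"
proof -
  have "\<delta> * (2 * C) \<le> \<nu> * g"
    using assms by (simp add: field_simps)
  moreover have "0 \<le> \<delta> * C" using assms by auto
  ultimately have "\<delta> * C \<le> \<nu> * g" by linarith
  then have "\<delta> * (\<delta> * C) \<le> \<delta> * (\<nu> * g)" using assms by (intro mult_left_mono) auto
  then show ?thesis using assms by (simp add: power2_eq_square)
qed

section \<open>Geometric decay along the good steps\<close>

lemma card_filter_lessThan_Suc:
  "card {i. i < Suc t \<and> P i} = card {i. i < t \<and> P i} + (if P t then 1 else 0)"
proof -
  have "{i. i < Suc t \<and> P i} = (if P t then insert t {i. i < t \<and> P i} else {i. i < t \<and> P i})"
    by (auto simp: less_Suc_eq)
  then show ?thesis by simp
qed

lemma linear_rate_with_drops: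
  fixes w g :: "nat \<Rightarrow> real" and drop :: "nat \<Rightarrow> bool" and F :: "real \<Rightarrow> real"
  defines "k \<equiv> \<lambda>t. card {i. i < t \<and> \<not> drop i}"
  assumes w: "\<And>t. 0 \<le> w t" and r: "0 \<le> r" "r \<le> 1"
    and F: "\<And>a b. 0 \<le> a \<Longrightarrow> a \<le> b \<Longrightarrow> F a \<le> F b"
    and start: "\<not> drop 0" "w 1 \<le> r\<^sup>2 * w 0" "g 0 \<le> F (r * w 0)"
    and mono: "\<And>t. w (Suc t) \<le> w t"
    and good: "\<And>t. \<not> drop t \<Longrightarrow> w (Suc t) \<le> r * w t" "\<And>t. \<not> drop t \<Longrightarrow> g t \<le> F (w t)"
  shows "w t \<le> w 0 * r ^ k t" "Min (g ` {..T}) \<le> F (w 0 * r ^ k T)"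
proof -
  have k0: "k 0 = 0" by (simp add: k_def)
  have kS: "k (Suc t) = k t + (if drop t then 0 else 1)" for t
    using card_filter_lessThan_Suc[of t "\<lambda>i. \<not> drop i"] by (simp add: k_def)
  \<comment> \<open>The spare factor r earned by the first step survives: good steps multiply both
    sides by r, and drop steps change neither k nor the bound.\<close>
  have late: "w (Suc t) \<le> w 0 * r ^ Suc (k (Suc t))" for t
  proof (induction t)
    case 0
    then show ?case using start by (simp add: kS k0 power2_eq_square mult.commute)
  next
    case (Suc t)
    show ?case
    proof (cases "drop (Suc t)")
      case True
      then show ?thesis using Suc mono[of "Suc t"] kS[of "Suc t"] by simp
    next
      case False
      then have "w (Suc (Suc t)) \<le> r * w (Suc t)" by (rule good)
      also have "\<dots> \<le> r * (w 0 * r ^ Suc (k (Suc t)))" using Suc r by (intro mult_left_mono) auto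
      finally show ?thesis using False kS[of "Suc t"] by (simp add: mult_ac)
    qed
  qed
  have step: "w 0 * r ^ Suc j \<le> w 0 * r ^ j" for j
    using r w[of 0] by (intro mult_left_mono power_decreasing) auto
  show "w t \<le> w 0 * r ^ k t"
  proof (cases t)
    case 0 then show ?thesis by (simp add: k0)
  next
    case (Suc s) then show ?thesis using late[of s] step[of "k t"] by simp
  qed
  have gS: "g t \<le> F (w 0 * r ^ k (Suc t))" if "\<not> drop t" for t
  proof (cases t)
    case 0 then show ?thesis using start by (simp add: kS k0 mult.commute)
  next
    case (Suc s)
    have "g t \<le> F (w t)" using that by (rule good)
    also have "\<dots> \<le> F (w 0 * r ^ k (Suc t))"
      using late[of s] w that by (intro F) (auto simp: Suc kS[of "Suc s"])
    finally show ?thesis .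
  qed
  \<comment> \<open>The exponent k(T+1) makes the statement inductive: if step T+1 is a drop step,
    then k(T+2) = k(T+1) and the earlier witness remains valid. The exponent k(T) is recovered at
    the end by monotonicity.\<close>
  have "\<exists>t\<le>T. g t \<le> F (w 0 * r ^ k (Suc T))"
  proof (induction T)
    case 0
    then show ?case using gS[OF start(1)] by auto
  next
    case (Suc T)
    show ?case
    proof (cases "drop (Suc T)")
      case True
      then show ?thesis using Suc kS[of "Suc T"] by (metis add.right_neutral le_SucI)
    next
      case False
      then show ?thesis using gS by blast
    qed
  qed
  then obtain t where t: "t \<le> T" "g t \<le> F (w 0 * r ^ k (Suc T))" by blast
  have "Min (g ` {..T}) \<le> g t" using t(1) by (intro Min_le) auto
  also note t(2)
  also have "F (w 0 * r ^ k (Suc T)) \<le> F (w 0 * r ^ k T)"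
    using step[of "k T"] r w[of 0] by (intro F) (auto simp: kS[of T])
  finally show "Min (g ` {..T}) \<le> F (w 0 * r ^ k T)" .
qed

section \<open>Active sets of SP-AFW\<close>

text \<open>The invariant of SP-AFW that ties the stored weights to the iterate. A run updates
  weights and iterates separately, and active sets are only read off as the positive weights, so the
  invariant has to be proved.\<close>

definition weights_on :: "'a::real_vector set \<Rightarrow> 'a \<Rightarrow> ('a \<Rightarrow> real) \<Rightarrow> bool" where
  "weights_on A x a \<longleftrightarrow> (\<forall>v. 0 \<le> a v) \<and> sum a A = 1 \<and> (\<Sum>v\<in>A. a v *\<^sub>R v) = x"

lemma weights_on_singleton:
  assumes "finite A" "x \<in> A"
  shows "weights_on A x (\<lambda>v. if v = x then 1 else 0)"
  using assms unfolding weights_on_def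
  by (auto simp: if_distrib[where f = "\<lambda>c. c *\<^sub>R _"] cong: if_cong)

lemma weights_on_conv_reps:
  assumes "finite A" "weights_on A x a"
  shows "{v\<in>A. 0 < a v} \<in> conv_reps A x"
proof -
  have a: "\<And>v. 0 \<le> a v" "sum a A = 1" "(\<Sum>v\<in>A. a v *\<^sub>R v) = x"
    using assms(2) by (auto simp: weights_on_def)
  have "sum a {v\<in>A. 0 < a v} = sum a A"
    using a(1) assms(1) by (intro sum.mono_neutral_left) (auto simp: not_less order_antisym)
  moreover have "(\<Sum>v\<in>{v\<in>A. 0 < a v}. a v *\<^sub>R v) = (\<Sum>v\<in>A. a v *\<^sub>R v)"
    using a(1) assms(1) by (intro sum.mono_neutral_left) (auto simp: not_less order_antisym)
  ultimately show ?thesis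
    using a unfolding conv_reps_def by (auto intro!: exI[of _ a])
qed

lemma weights_on_hull:
  assumes "finite A" "weights_on A x a"
  shows "x \<in> convex hull A"
  using assms unfolding convex_hull_finite[OF assms(1)] weights_on_def by blast

lemma weights_on_le_1:
  assumes "finite A" "weights_on A x a" "v \<in> A"
  shows "a v \<le> 1"
  using assms member_le_sum[of v A a] by (auto simp: weights_on_def)

lemma weights_on_card_pos:
  assumes "finite A" "weights_on A x a"
  shows "1 \<le> card {v\<in>A. 0 < a v}"
  using conv_reps_subset_hull(1)[OF assms(1) weights_on_conv_reps[OF assms]] assms(1)
  by (auto simp: Suc_le_eq card_gt_0_iff simp del: Collect_empty_eq Collect_conv_if)

lemma weights_on_full_weight:
  assumes "finite A" "weights_on A x a" "v \<in> A" "a v = 1"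
  shows "x = v"
proof -
  have a: "\<And>v. 0 \<le> a v" "sum a A = 1" "(\<Sum>v\<in>A. a v *\<^sub>R v) = x"
    using assms(2) by (auto simp: weights_on_def)
  have "sum a (A - {v}) = 0"
    using a(2) assms by (simp add: sum.remove[OF assms(1,3)])
  then have "\<forall>u\<in>A - {v}. a u = 0"
    using a(1) assms(1) by (subst (asm) sum_nonneg_eq_0_iff) auto
  then have "(\<Sum>u\<in>A. a u *\<^sub>R u) = v"
    using assms by (simp add: sum.remove[OF assms(1,3)])
  then show ?thesis using a by simp
qed

lemma weights_on_fw_step:
  assumes "finite A" "weights_on A x a" "s \<in> A" "0 \<le> \<gamma>" "\<gamma> \<le> 1"
  defines "a' \<equiv> \<lambda>v. (1 - \<gamma>) * a v + (if v = s then \<gamma> else 0)"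
  shows "weights_on A (x + \<gamma> *\<^sub>R (s - x)) a'"
    and "card {v\<in>A. 0 < a' v} \<le> card {v\<in>A. 0 < a v} + 1"
proof -
  have a: "\<And>v. 0 \<le> a v" "sum a A = 1" "(\<Sum>v\<in>A. a v *\<^sub>R v) = x"
    using assms(2) by (auto simp: weights_on_def)
  have "(\<Sum>v\<in>A. a' v *\<^sub>R v) = (1 - \<gamma>) *\<^sub>R (\<Sum>v\<in>A. a v *\<^sub>R v) + (\<Sum>v\<in>A. if v = s then \<gamma> *\<^sub>R v else 0)"
    unfolding scaleR_sum_right sum.distrib[symmetric] a'_def
    by (intro sum.cong) (auto simp: scaleR_add_left)
  also have "\<dots> = x + \<gamma> *\<^sub>R (s - x)"
    using assms a by (simp add: sum.delta algebra_simps)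
  finally have 1: "(\<Sum>v\<in>A. a' v *\<^sub>R v) = x + \<gamma> *\<^sub>R (s - x)" .
  have 2: "sum a' A = 1"
    using assms a by (simp add: a'_def sum.distrib sum.delta sum_distrib_left[symmetric])
  have 3: "0 \<le> a' v" for v
    using a(1)[of v] assms(4,5) by (auto simp: a'_def)
  show "weights_on A (x + \<gamma> *\<^sub>R (s - x)) a'"
    using 1 2 3 by (auto simp: weights_on_def)
  have "{v\<in>A. 0 < a' v} \<subseteq> insert s {v\<in>A. 0 < a v}"
  proof
    fix v assume v: "v \<in> {v\<in>A. 0 < a' v}"
    then have "v = s \<or> a v \<noteq> 0" by (auto simp: a'_def)
    then show "v \<in> insert s {v\<in>A. 0 < a v}" using a(1)[of v] v by auto
  qed
  then have "card {v\<in>A. 0 < a' v} \<le> card (insert s {v\<in>A. 0 < a v})"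
    using assms(1) by (intro card_mono) auto
  also have "\<dots> \<le> card {v\<in>A. 0 < a v} + 1"
    using assms(1) by (simp add: card_insert_if)
  finally show "card {v\<in>A. 0 < a' v} \<le> card {v\<in>A. 0 < a v} + 1" .
qed

text \<open>The condition \<open>\<gamma> * (1 - a v) \<le> a v\<close> is the maximal step length
  without a division. It says that the new weight of v is nonnegative, with equality exactly when v
  leaves the active set, and it is vacuous when v carries all the weight.\<close>

lemma weights_on_away_step:
  assumes "finite A" "weights_on A x a" "v \<in> A" "0 < a v" "0 \<le> \<gamma>" "\<gamma> * (1 - a v) \<le> a v"
  defines "a' \<equiv> \<lambda>u. (1 + \<gamma>) * a u - (if u = v then \<gamma> else 0)"
  shows "weights_on A (x + \<gamma> *\<^sub>R (x - v)) a'"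
    and "card {u\<in>A. 0 < a' u} \<le> card {u\<in>A. 0 < a u}"
    and "\<gamma> * (1 - a v) = a v \<Longrightarrow> card {u\<in>A. 0 < a' u} + 1 \<le> card {u\<in>A. 0 < a u}"
proof -
  have a: "\<And>v. 0 \<le> a v" "sum a A = 1" "(\<Sum>v\<in>A. a v *\<^sub>R v) = x"
    using assms(2) by (auto simp: weights_on_def)
  have "(\<Sum>u\<in>A. a' u *\<^sub>R u) = (1 + \<gamma>) *\<^sub>R (\<Sum>v\<in>A. a v *\<^sub>R v) - (\<Sum>u\<in>A. if u = v then \<gamma> *\<^sub>R u else 0)"
    unfolding scaleR_sum_right sum_subtractf[symmetric] a'_def
    by (intro sum.cong) (auto simp: scaleR_diff_left)
  also have "\<dots> = x + \<gamma> *\<^sub>R (x - v)"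
    using assms a by (simp add: sum.delta algebra_simps)
  finally have 1: "(\<Sum>u\<in>A. a' u *\<^sub>R u) = x + \<gamma> *\<^sub>R (x - v)" .
  have 2: "sum a' A = 1"
    using assms a by (simp add: a'_def sum_subtractf sum.delta sum_distrib_left[symmetric])
  have 3: "0 \<le> a' u" for u
    using a(1)[of u] assms(5,6) by (auto simp: a'_def algebra_simps)
  show "weights_on A (x + \<gamma> *\<^sub>R (x - v)) a'"
    using 1 2 3 by (auto simp: weights_on_def)
  have sub: "{u\<in>A. 0 < a' u} \<subseteq> {u\<in>A. 0 < a u}"
    using assms(4,5) by (auto simp: a'_def zero_less_mult_iff split: if_splits)
  then show "card {u\<in>A. 0 < a' u} \<le> card {u\<in>A. 0 < a u}"
    using assms(1) by (intro card_mono) auto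
  assume "\<gamma> * (1 - a v) = a v"
  then have "a' v = 0" by (simp add: a'_def algebra_simps)
  then have "{u\<in>A. 0 < a' u} \<subset> {u\<in>A. 0 < a u}"
    using sub assms(3,4) by force
  then show "card {u\<in>A. 0 < a' u} + 1 \<le> card {u\<in>A. 0 < a u}"
    using assms(1) psubset_card_mono[of "{u\<in>A. 0 < a u}"] by (simp add: Suc_le_eq)
qed

lemma away_max_bounds:
  assumes "0 < a" "a \<le> 1" "0 < b" "b \<le> 1"
  shows "0 \<le> away_max a b"
    and "\<gamma> \<le> away_max a b \<Longrightarrow> \<gamma> * (1 - a) \<le> a \<and> \<gamma> * (1 - b) \<le> b"
    and "a \<noteq> 1 \<or> b \<noteq> 1 \<Longrightarrow> away_max a b * (1 - a) = a \<or> away_max a b * (1 - b) = b"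
proof -
  have *: "a \<noteq> 1 \<Longrightarrow> 0 < 1 - a" "b \<noteq> 1 \<Longrightarrow> 0 < 1 - b" using assms by auto
  show "0 \<le> away_max a b"
    using assms by (auto simp: away_max_def)
  show "\<gamma> \<le> away_max a b \<Longrightarrow> \<gamma> * (1 - a) \<le> a \<and> \<gamma> * (1 - b) \<le> b"
    using assms * by (cases "a = 1"; cases "b = 1") (auto simp: away_max_def pos_le_divide_eq)
  show "a \<noteq> 1 \<or> b \<noteq> 1 \<Longrightarrow> away_max a b * (1 - a) = a \<or> away_max a b * (1 - b) = b"
    using * by (auto simp: away_max_def min_def)
qed

lemma inner_le_on_convex_hull:
  fixes r :: "'a::real_inner"
  assumes "\<And>u. u \<in> A \<Longrightarrow> r \<bullet> u \<le> m" "z \<in> convex hull A"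
  shows "r \<bullet> z \<le> m"
  using inner_ge_on_convex_hull[of A "- m" "- r" z] assms by auto

text \<open>Both kinds of step in one form, as displacements along a - b and c - d. The larger of
  the Frank-Wolfe and away gaps is at least half their sum, whence the slope g/2. If the away
  vertices equal the iterate, the away gap is zero and a Frank-Wolfe step with the full slope is
  taken.\<close>

lemma spafw_step:
  assumes run: "spafw_run A B Gx Gy \<eta> x y ax ay g isdrop" and fin: "finite A" "finite B" and \<eta>: "0 \<le> \<eta>"
    and wx: "weights_on A (x t) (ax t)" and wy: "weights_on B (y t) (ay t)"
  defines "rx \<equiv> Gx (x t) (y t)" and "ry \<equiv> - Gy (x t) (y t)"
    and "Sx \<equiv> \<lambda>t. {v\<in>A. 0 < ax t v}" and "Sy \<equiv> \<lambda>t. {v\<in>B. 0 < ay t v}"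
  obtains sx sy vx vy a b c d \<gamma> where
    "sx \<in> A" "\<And>u. u \<in> A \<Longrightarrow> rx \<bullet> sx \<le> rx \<bullet> u" "sy \<in> B" "\<And>u. u \<in> B \<Longrightarrow> ry \<bullet> sy \<le> ry \<bullet> u"
    "vx \<in> Sx t" "\<And>u. u \<in> Sx t \<Longrightarrow> rx \<bullet> u \<le> rx \<bullet> vx" "vy \<in> Sy t" "\<And>u. u \<in> Sy t \<Longrightarrow> ry \<bullet> u \<le> ry \<bullet> vy"
    "g t = rx \<bullet> (vx - sx) + ry \<bullet> (vy - sy)" "0 \<le> rx \<bullet> (vx - sx)" "0 \<le> ry \<bullet> (vy - sy)"
    "a \<in> convex hull A" "b \<in> convex hull A" "c \<in> convex hull B" "d \<in> convex hull B"
    "x (Suc t) = x t + \<gamma> *\<^sub>R (a - b)" "y (Suc t) = y t + \<gamma> *\<^sub>R (c - d)"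
    "0 \<le> \<gamma>" "\<gamma> \<le> \<eta> * g t" "\<not> isdrop t \<Longrightarrow> \<gamma> = \<eta> * g t \<or> \<gamma> = 1 \<and> 1 \<le> \<eta> * g t"
    "g t / 2 \<le> - ((a - b) \<bullet> rx + (c - d) \<bullet> ry)"
    "vx = x t \<Longrightarrow> vy = y t \<Longrightarrow> g t \<le> - ((a - b) \<bullet> rx + (c - d) \<bullet> ry) \<and> \<not> isdrop t"
    "weights_on A (x (Suc t)) (ax (Suc t))" "weights_on B (y (Suc t)) (ay (Suc t))"
    "card (Sx (Suc t)) + card (Sy (Suc t)) + (if isdrop t then 1 else 0)
       \<le> card (Sx t) + card (Sy t) + 2 * (if isdrop t then 0 else 1)"
proof -
  obtain sx sy vx vy \<gamma> where
    s: "sx \<in> A" "sy \<in> B" "\<forall>u\<in>A. rx \<bullet> sx \<le> rx \<bullet> u" "\<forall>u\<in>B. ry \<bullet> sy \<le> ry \<bullet> u" and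
    v: "vx \<in> Sx t" "vy \<in> Sy t" "\<forall>u\<in>Sx t. rx \<bullet> u \<le> rx \<bullet> vx" "\<forall>u\<in>Sy t. ry \<bullet> u \<le> ry \<bullet> vy" and
    st: "let fw = - (rx \<bullet> (sx - x t) + ry \<bullet> (sy - y t));
               aw = - (rx \<bullet> (x t - vx) + ry \<bullet> (y t - vy)) in
           g t = fw + aw \<and>
           (if aw \<le> fw then
              \<gamma> = min 1 (\<eta> * g t) \<and>
              x (Suc t) = x t + \<gamma> *\<^sub>R (sx - x t) \<and> y (Suc t) = y t + \<gamma> *\<^sub>R (sy - y t) \<and>
              ax (Suc t) = (\<lambda>v. (1 - \<gamma>) * ax t v + (if v = sx then \<gamma> else 0)) \<and>
              ay (Suc t) = (\<lambda>v. (1 - \<gamma>) * ay t v + (if v = sy then \<gamma> else 0)) \<and>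
              \<not> isdrop t
            else
              \<gamma> = min (away_max (ax t vx) (ay t vy)) (\<eta> * g t) \<and>
              x (Suc t) = x t + \<gamma> *\<^sub>R (x t - vx) \<and> y (Suc t) = y t + \<gamma> *\<^sub>R (y t - vy) \<and>
              ax (Suc t) = (\<lambda>v. (1 + \<gamma>) * ax t v - (if v = vx then \<gamma> else 0)) \<and>
              ay (Suc t) = (\<lambda>v. (1 + \<gamma>) * ay t v - (if v = vy then \<gamma> else 0)) \<and>
              (isdrop t \<longleftrightarrow> \<gamma> = away_max (ax t vx) (ay t vy)))"
    using run[unfolded spafw_run_def Let_def, THEN conjunct2, THEN conjunct2, THEN conjunct2,
        THEN conjunct2, rule_format, of t]
    unfolding rx_def ry_def Sx_def Sy_def Let_def by blast
  define fw where "fw = - (rx \<bullet> (sx - x t) + ry \<bullet> (sy - y t))"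
  define aw where "aw = - (rx \<bullet> (x t - vx) + ry \<bullet> (y t - vy))"
  note st = st[unfolded Let_def, folded fw_def aw_def]
  have repx: "Sx t \<in> conv_reps A (x t)" and repy: "Sy t \<in> conv_reps B (y t)"
    using weights_on_conv_reps fin wx wy by (auto simp: Sx_def Sy_def)
  have hx: "x t \<in> convex hull (Sx t)" and hy: "y t \<in> convex hull (Sy t)"
    using conv_reps_subset_hull(1) fin repx repy by metis+
  have xA: "x t \<in> convex hull A" and yB: "y t \<in> convex hull B"
    using weights_on_hull fin wx wy by auto
  have vA: "vx \<in> A" "vy \<in> B" "0 < ax t vx" "0 < ay t vy" using v by (auto simp: Sx_def Sy_def)
  have ss: "rx \<bullet> sx \<le> rx \<bullet> x t" "ry \<bullet> sy \<le> ry \<bullet> y t"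
    using inner_ge_on_convex_hull[OF _ xA, of "rx \<bullet> sx" rx] inner_ge_on_convex_hull[OF _ yB, of "ry \<bullet> sy" ry] s by auto
  have vv: "rx \<bullet> x t \<le> rx \<bullet> vx" "ry \<bullet> y t \<le> ry \<bullet> vy"
    using inner_le_on_convex_hull[OF _ hx, of rx "rx \<bullet> vx"] inner_le_on_convex_hull[OF _ hy, of ry "ry \<bullet> vy"] v by auto
  have g: "g t = fw + aw" using st by blast
  have fwaw: "0 \<le> fw" "0 \<le> aw"
    using ss vv by (auto simp: fw_def aw_def inner_diff_right)
  have g0: "0 \<le> \<eta> * g t" using g fwaw \<eta> by simp
  have gg: "g t = rx \<bullet> (vx - sx) + ry \<bullet> (vy - sy)" "0 \<le> rx \<bullet> (vx - sx)" "0 \<le> ry \<bullet> (vy - sy)"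
    using g ss vv by (auto simp: fw_def aw_def inner_diff_right)
  have sh: "sx \<in> convex hull A" "sy \<in> convex hull B" "vx \<in> convex hull A" "vy \<in> convex hull B"
    using s vA by (auto intro: hull_inc)
  note common = s(1) s(3)[rule_format] s(2) s(4)[rule_format] v(1) v(3)[rule_format] v(2) v(4)[rule_format] gg
  show ?thesis
  proof (cases "aw \<le> fw")
    case True
    with st have \<gamma>: "\<gamma> = min 1 (\<eta> * g t)" and
      up: "x (Suc t) = x t + \<gamma> *\<^sub>R (sx - x t)" "y (Suc t) = y t + \<gamma> *\<^sub>R (sy - y t)"
        "ax (Suc t) = (\<lambda>v. (1 - \<gamma>) * ax t v + (if v = sx then \<gamma> else 0))"
        "ay (Suc t) = (\<lambda>v. (1 - \<gamma>) * ay t v + (if v = sy then \<gamma> else 0))" and nd: "\<not> isdrop t"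
      by auto
    have \<gamma>01: "0 \<le> \<gamma>" "\<gamma> \<le> 1" using \<gamma> g0 by auto
    note ux = weights_on_fw_step[OF fin(1) wx s(1) \<gamma>01]
    note uy = weights_on_fw_step[OF fin(2) wy s(2) \<gamma>01]
    have slope: "- ((sx - x t) \<bullet> rx + (sy - y t) \<bullet> ry) = fw"
      by (simp add: fw_def inner_commute)
    show ?thesis
    proof (rule that[OF common sh(1) xA sh(2) yB up(1,2) \<gamma>01(1)])
      show "vx = x t \<Longrightarrow> vy = y t \<Longrightarrow> g t \<le> - ((sx - x t) \<bullet> rx + (sy - y t) \<bullet> ry) \<and> \<not> isdrop t"
        using nd unfolding slope by (simp add: g aw_def)
      show "card (Sx (Suc t)) + card (Sy (Suc t)) + (if isdrop t then 1 else 0)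
         \<le> card (Sx t) + card (Sy t) + 2 * (if isdrop t then 0 else 1)"
        using nd ux(2) uy(2) by (simp add: Sx_def Sy_def up)
    qed (use \<gamma> g True slope nd ux(1) uy(1) up in \<open>auto simp: min_def split: if_splits\<close>)
  next
    case False
    define m where "m = away_max (ax t vx) (ay t vy)"
    have \<gamma>: "\<gamma> = min m (\<eta> * g t)" and
      up: "x (Suc t) = x t + \<gamma> *\<^sub>R (x t - vx)" "y (Suc t) = y t + \<gamma> *\<^sub>R (y t - vy)"
        "ax (Suc t) = (\<lambda>v. (1 + \<gamma>) * ax t v - (if v = vx then \<gamma> else 0))"
        "ay (Suc t) = (\<lambda>v. (1 + \<gamma>) * ay t v - (if v = vy then \<gamma> else 0))"
      and dr: "isdrop t \<longleftrightarrow> \<gamma> = m"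
      using st False by (auto simp: m_def)
    have le1: "ax t vx \<le> 1" "ay t vy \<le> 1"
      using weights_on_le_1 fin wx wy vA by metis+
    note am = away_max_bounds[OF vA(3) le1(1) vA(4) le1(2), folded m_def]
    have \<gamma>0: "0 \<le> \<gamma>" "\<gamma> \<le> m" using \<gamma> g0 am(1) by auto
    note ab = am(2)[OF \<gamma>0(2)]
    note ux = weights_on_away_step[OF fin(1) wx vA(1,3) \<gamma>0(1) ab[THEN conjunct1]]
    note uy = weights_on_away_step[OF fin(2) wy vA(2,4) \<gamma>0(1) ab[THEN conjunct2]]
    have S0: "Sx t = {u\<in>A. 0 < ax t u}" "Sy t = {u\<in>B. 0 < ay t u}"
      and S': "Sx (Suc t) = {u\<in>A. 0 < (1 + \<gamma>) * ax t u - (if u = vx then \<gamma> else 0)}"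
        "Sy (Suc t) = {u\<in>B. 0 < (1 + \<gamma>) * ay t u - (if u = vy then \<gamma> else 0)}"
      by (simp_all only: Sx_def Sy_def up(3,4))
    have slope: "- ((x t - vx) \<bullet> rx + (y t - vy) \<bullet> ry) = aw"
      by (simp add: aw_def inner_commute)
    \<comment> \<open>An away step is taken only if the away gap is strictly positive, hence not
      from a point that is a single atom in both blocks. This excludes the case where
      \<open>away_max\<close> is 0 by division by zero, in which a drop step would remove
      nothing.\<close>
    have nf: "ax t vx \<noteq> 1 \<or> ay t vy \<noteq> 1"
    proof (rule ccontr)
      assume "\<not> ?thesis"
      then have "x t = vx" "y t = vy"
        using weights_on_full_weight fin wx wy vA by metis+
      then show False using False fwaw by (simp add: aw_def)
    qed
    show ?thesis
    proof (rule that[OF common xA sh(3) yB sh(4) up(1,2) \<gamma>0(1)])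
      show "vx = x t \<Longrightarrow> vy = y t \<Longrightarrow> g t \<le> - ((x t - vx) \<bullet> rx + (y t - vy) \<bullet> ry) \<and> \<not> isdrop t"
        using False fwaw by (simp add: aw_def)
      show "card (Sx (Suc t)) + card (Sy (Suc t)) + (if isdrop t then 1 else 0)
         \<le> card (Sx t) + card (Sy t) + 2 * (if isdrop t then 0 else 1)"
      proof (cases "isdrop t")
        case True
        then have "\<gamma> * (1 - ax t vx) = ax t vx \<or> \<gamma> * (1 - ay t vy) = ay t vy"
          using dr am(3)[OF nf] by auto
        then show ?thesis
          using True ux(2,3) uy(2,3) unfolding S' S0 by (auto split del: if_split)
      next
        case False
        then show ?thesis using ux(2) uy(2) unfolding S' S0 by (simp split del: if_split)
      qed
    qed (use \<gamma> g False slope dr ux(1) uy(1) up in \<open>auto simp: min_def split: if_splits\<close>)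
  qed
qed

lemma spafw_weights:
  assumes run: "spafw_run A B Gx Gy \<eta> x y ax ay g isdrop" and fin: "finite A" "finite B" and \<eta>: "0 \<le> \<eta>"
  shows "weights_on A (x t) (ax t) \<and> weights_on B (y t) (ay t)"
proof (induction t)
  case 0
  show ?case
    using run fin unfolding spafw_run_def by (simp add: weights_on_singleton)
next
  case (Suc t)
  show ?case
    by (rule spafw_step[OF run fin \<eta> Suc[THEN conjunct1] Suc[THEN conjunct2]]) blast
qed

text \<open>Amortisation: a good step adds at most two atoms, a drop step removes at least one.\<close>

lemma spafw_good_steps:
  assumes run: "spafw_run A B Gx Gy \<eta> x y ax ay g isdrop" and fin: "finite A" "finite B" and \<eta>: "0 \<le> \<eta>"
  shows "real t / 3 \<le> real (card {i. i < t \<and> \<not> isdrop i})"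
proof -
  let ?S = "\<lambda>t. card {v\<in>A. 0 < ax t v} + card {v\<in>B. 0 < ay t v}"
  have W: "weights_on A (x t) (ax t)" "weights_on B (y t) (ay t)" for t
    using spafw_weights[OF assms] by auto
  have "?S t + card {i. i < t \<and> isdrop i} \<le> 2 + 2 * card {i. i < t \<and> \<not> isdrop i}"
  proof (induction t)
    case 0
    have "{v\<in>A. 0 < ax 0 v} = {x 0}" "{v\<in>B. 0 < ay 0 v} = {y 0}"
      using run unfolding spafw_run_def by auto
    then show ?case by simp
  next
    case (Suc t)
    have "?S (Suc t) + (if isdrop t then 1 else 0) \<le> ?S t + 2 * (if isdrop t then 0 else 1)"
      by (rule spafw_step[OF run fin \<eta> W]) blast
    then show ?case using Suc by (auto simp: card_filter_lessThan_Suc split: if_splits)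
  qed
  \<comment> \<open>Each block always keeps an atom, which cancels the two initial ones and leaves
    at most two drop steps per good step.\<close>
  moreover have "2 \<le> ?S t"
    using weights_on_card_pos[OF fin(1) W(1)[of t]] weights_on_card_pos[OF fin(2) W(2)[of t]] by simp
  moreover have "t = card {i. i < t \<and> isdrop i} + card {i. i < t \<and> \<not> isdrop i}"
    by (induction t) (auto simp: card_filter_lessThan_Suc)
  ultimately have "t \<le> 3 * card {i. i < t \<and> \<not> isdrop i}" by linarith
  then show ?thesis by simp
qed

section \<open>Saddle point problems\<close>

text \<open>Passes from an extended real constant to a real one: the element e rules out the value
  \<infinity> and supplies the upper bound, later used with c = 2C.\<close>

lemma min_INF_Inf_ereal:
  fixes S :: "'i \<Rightarrow> real set" and T :: "'j \<Rightarrow> real set"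
  assumes m_def: "m = min (INF i\<in>I. Inf (ereal ` S i)) (INF j\<in>J. Inf (ereal ` T j))"
    and pos: "0 < m" and e: "e \<in> (\<Union>i\<in>I. S i) \<union> (\<Union>j\<in>J. T j)" "e \<le> c"
  obtains \<mu> where "m = ereal \<mu>" "0 < \<mu>" "\<mu> \<le> c"
    "\<And>i e. i \<in> I \<Longrightarrow> e \<in> S i \<Longrightarrow> \<mu> \<le> e" "\<And>j e. j \<in> J \<Longrightarrow> e \<in> T j \<Longrightarrow> \<mu> \<le> e"
proof -
  have S: "m \<le> ereal e" if "i \<in> I" "e \<in> S i" for i e
    unfolding m_def using that by (intro min.coboundedI1 INF_lower2[of i] Inf_lower) auto
  have T: "m \<le> ereal e" if "j \<in> J" "e \<in> T j" for j e
    unfolding m_def using that by (intro min.coboundedI2 INF_lower2[of j] Inf_lower) auto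
  have "m \<le> ereal e" using e(1) S T by blast
  then obtain \<mu> where \<mu>: "m = ereal \<mu>" using pos by (cases m) auto
  show ?thesis
  proof (rule that[OF \<mu>])
    show "0 < \<mu>" using pos \<mu> by simp
    show "\<mu> \<le> c" using \<open>m \<le> ereal e\<close> e(2) \<mu> by simp
  qed (use S T \<mu> in auto)
qed

locale saddle_problem =
  fixes X :: "'a::euclidean_space set" and Y :: "'b::euclidean_space set"
    and L :: "'a \<Rightarrow> 'b \<Rightarrow> real"
    and Gx :: "'a \<Rightarrow> 'b \<Rightarrow> 'a" and Gy :: "'a \<Rightarrow> 'b \<Rightarrow> 'b"
    and xs :: 'a and ys :: 'b and \<mu>X \<mu>Y :: real
  assumes X: "convex X" "compact X" and Y: "convex Y" "compact Y"
    and diff: "\<And>x y. x \<in> X \<Longrightarrow> y \<in> Y \<Longrightarrow> ((\<lambda>z. L (fst z) (snd z)) has_derivative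
                 (\<lambda>h. Gx x y \<bullet> fst h + Gy x y \<bullet> snd h)) (at (x, y) within X \<times> Y)"
    and sc: "0 < \<mu>X" "0 < \<mu>Y" "\<And>y. y \<in> Y \<Longrightarrow> strongly_convex_on X \<mu>X (\<lambda>x. L x y)"
      "\<And>x. x \<in> X \<Longrightarrow> strongly_convex_on Y \<mu>Y (\<lambda>y. - L x y)"
    and saddle: "xs \<in> X" "ys \<in> Y" "\<And>y. y \<in> Y \<Longrightarrow> L xs y \<le> L xs ys" "\<And>x. x \<in> X \<Longrightarrow> L xs ys \<le> L x ys"
    and curv_fin: "curv_L X Y L Gx Gy < \<infinity>"
begin

abbreviation "C \<equiv> real_of_ereal (curv_L X Y L Gx Gy)"
abbreviation "w \<equiv> wgap L xs ys"

lemma deriv_x: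
  assumes "x \<in> X" "y \<in> Y"
  shows "((\<lambda>x. L x y) has_derivative (\<lambda>h. Gx x y \<bullet> h)) (at x within X)"
proof -
  have "((\<lambda>x. (x, y)) has_derivative (\<lambda>h. (h, 0))) (at x within X)"
    by (auto intro!: derivative_eq_intros)
  moreover have "((\<lambda>z. L (fst z) (snd z)) has_derivative
      (\<lambda>h. Gx x y \<bullet> fst h + Gy x y \<bullet> snd h)) (at (x, y) within (\<lambda>x. (x, y)) ` X)"
    using diff[OF assms] by (rule has_derivative_subset) (use assms in auto)
  ultimately show ?thesis
    by (drule_tac diff_chain_within) (auto simp: o_def)
qed

lemma deriv_y:
  assumes "x \<in> X" "y \<in> Y"
  shows "((\<lambda>y. - L x y) has_derivative (\<lambda>h. (- Gy x y) \<bullet> h)) (at y within Y)"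
proof -
  have "((\<lambda>y. (x, y)) has_derivative (\<lambda>h. (0, h))) (at y within Y)"
    by (auto intro!: derivative_eq_intros)
  moreover have "((\<lambda>z. L (fst z) (snd z)) has_derivative
      (\<lambda>h. Gx x y \<bullet> fst h + Gy x y \<bullet> snd h)) (at (x, y) within (\<lambda>y. (x, y)) ` Y)"
    using diff[OF assms] by (rule has_derivative_subset) (use assms in auto)
  ultimately have "((\<lambda>y. L x y) has_derivative (\<lambda>h. Gy x y \<bullet> h)) (at y within Y)"
    by (drule_tac diff_chain_within) (auto simp: o_def)
  then show ?thesis by (auto dest: has_derivative_minus)
qed

lemma first_order_x:
  assumes "x \<in> X" "x' \<in> X" "y \<in> Y"
  shows "Gx x y \<bullet> (x' - x) \<le> L x' y - L x y"
  using strongly_convex_first_order[OF X(1) sc(3)[OF assms(3)] sc(1) deriv_x] assms by blast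

lemma first_order_y:
  assumes "x \<in> X" "y \<in> Y" "y' \<in> Y"
  shows "(- Gy x y) \<bullet> (y' - y) \<le> - L x y' - - L x y"
  using strongly_convex_first_order[OF Y(1) sc(4)[OF assms(1)] sc(2) deriv_y] assms by blast

lemma strict_x: "x \<in> X \<Longrightarrow> x \<noteq> xs \<Longrightarrow> L xs ys < L x ys"
  using strongly_convex_unique_min[OF X(1) sc(3)[OF saddle(2)] sc(1), of x xs] saddle by auto

lemma strict_y: "y \<in> Y \<Longrightarrow> y \<noteq> ys \<Longrightarrow> L xs y < L xs ys"
  using strongly_convex_unique_min[OF Y(1) sc(4)[OF saddle(1)] sc(2), of y ys] saddle by auto

lemma w_nonneg: "x \<in> X \<Longrightarrow> y \<in> Y \<Longrightarrow> 0 \<le> w x y"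
  using saddle(3)[of y] saddle(4)[of x] by (simp add: wgap_def)

section \<open>The duality gap and the constant P\<close>

lemma y_hat: 
  assumes "x \<in> X"
  shows "y_hat Y L x \<in> Y" "\<And>y. y \<in> Y \<Longrightarrow> L x y \<le> L x (y_hat Y L x)"
proof -
  have "continuous_on Y (\<lambda>y. - L x y)"
    using deriv_y assms by (intro has_derivative_continuous_on) auto
  then have "\<exists>y\<in>Y. \<forall>y'\<in>Y. - L x y \<le> - L x y'"
    using saddle by (intro continuous_attains_inf Y) auto
  then have "\<exists>y. y \<in> Y \<and> (\<forall>y'\<in>Y. L x y' \<le> L x y)" by auto
  then have "y_hat Y L x \<in> Y \<and> (\<forall>y'\<in>Y. L x y' \<le> L x (y_hat Y L x))"
    unfolding y_hat_def by (rule someI_ex)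
  then show "y_hat Y L x \<in> Y" "\<And>y. y \<in> Y \<Longrightarrow> L x y \<le> L x (y_hat Y L x)" by auto
qed

lemma x_hat:
  assumes "y \<in> Y"
  shows "x_hat X L y \<in> X" "\<And>x. x \<in> X \<Longrightarrow> L (x_hat X L y) y \<le> L x y"
proof -
  have "continuous_on X (\<lambda>x. L x y)"
    using deriv_x assms by (intro has_derivative_continuous_on) auto
  then have "\<exists>x\<in>X. \<forall>x'\<in>X. L x y \<le> L x' y"
    using saddle by (intro continuous_attains_inf X) auto
  then have "\<exists>x. x \<in> X \<and> (\<forall>x'\<in>X. L x y \<le> L x' y)" by auto
  then have "x_hat X L y \<in> X \<and> (\<forall>x'\<in>X. L (x_hat X L y) y \<le> L x' y)"
    unfolding x_hat_def by (rule someI_ex)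
  then show "x_hat X L y \<in> X" "\<And>x. x \<in> X \<Longrightarrow> L (x_hat X L y) y \<le> L x y" by auto
qed

lemma hgap_eq:
  assumes "x \<in> X" "y \<in> Y"
  shows "hgap X Y L x y = L x (y_hat Y L x) - L (x_hat X L y) y"
proof -
  have "(SUP y'\<in>Y. L x y') = L x (y_hat Y L x)"
    using y_hat[OF assms(1)] by (intro cSup_eq_maximum) auto
  moreover have "(INF x'\<in>X. L x' y) = L (x_hat X L y) y"
    using x_hat[OF assms(2)] by (intro cInf_eq_minimum) auto
  ultimately show ?thesis by (simp add: hgap_def)
qed

text \<open>Replacing L at the saddle point by \<open>L xs (y_hat Y L x)\<close>, which is no
  larger, turns the primal error into a difference in x alone, and convexity bounds it by the
  numerator in P.\<close>

lemma P_X_bound: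
  assumes "x \<in> X" "x \<noteq> xs"
  shows "0 \<le> P_L X Y L Gx Gy xs ys"
    and "P_L X Y L Gx Gy xs ys = ereal p \<Longrightarrow> L x (y_hat Y L x) - L xs ys \<le> p * sqrt (L x ys - L xs ys)"
proof -
  let ?q = "(Gx x (y_hat Y L x) \<bullet> (x - xs)) / sqrt (L x ys - L xs ys)"
  have pos: "0 < sqrt (L x ys - L xs ys)" using strict_x assms by simp
  have fo: "L x (y_hat Y L x) - L xs (y_hat Y L x) \<le> Gx x (y_hat Y L x) \<bullet> (x - xs)"
    using first_order_x[of x xs "y_hat Y L x"] y_hat assms saddle by (simp add: inner_diff_right)
  have le: "L xs (y_hat Y L x) \<le> L xs ys" "L x ys \<le> L x (y_hat Y L x)"
    using y_hat assms saddle by auto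
  have q: "ereal ?q \<le> P_L X Y L Gx Gy xs ys"
    unfolding P_L_def using assms by (intro max.coboundedI1 Sup_upper) (auto simp: P_X_set_def)
  have "0 \<le> ?q" using fo le strict_x[OF assms] pos by (intro divide_nonneg_pos) auto
  then have "0 \<le> ereal ?q" by simp
  then show "0 \<le> P_L X Y L Gx Gy xs ys" using q by (rule order_trans)
  assume "P_L X Y L Gx Gy xs ys = ereal p"
  then have "?q \<le> p" using q by simp
  then have "Gx x (y_hat Y L x) \<bullet> (x - xs) \<le> p * sqrt (L x ys - L xs ys)"
    using pos by (simp add: pos_divide_le_eq)
  then show "L x (y_hat Y L x) - L xs ys \<le> p * sqrt (L x ys - L xs ys)"
    using fo le by linarith
qed

lemma P_Y_bound:
  assumes "y \<in> Y" "y \<noteq> ys"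
  shows "0 \<le> P_L X Y L Gx Gy xs ys"
    and "P_L X Y L Gx Gy xs ys = ereal p \<Longrightarrow> L xs ys - L (x_hat X L y) y \<le> p * sqrt (L xs ys - L xs y)"
proof -
  let ?q = "(Gy (x_hat X L y) y \<bullet> (ys - y)) / sqrt (L xs ys - L xs y)"
  have pos: "0 < sqrt (L xs ys - L xs y)" using strict_y assms by simp
  have fo: "L (x_hat X L y) ys - L (x_hat X L y) y \<le> Gy (x_hat X L y) y \<bullet> (ys - y)"
    using first_order_y[of "x_hat X L y" y ys] x_hat assms saddle by (simp add: inner_diff_right)
  have le: "L xs ys \<le> L (x_hat X L y) ys" "L (x_hat X L y) y \<le> L xs y"
    using x_hat assms saddle by auto
  have q: "ereal ?q \<le> P_L X Y L Gx Gy xs ys"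
    unfolding P_L_def using assms by (intro max.coboundedI2 Sup_upper) (auto simp: P_Y_set_def)
  have "0 \<le> ?q" using fo le strict_y[OF assms] pos by (intro divide_nonneg_pos) auto
  then have "0 \<le> ereal ?q" by simp
  then show "0 \<le> P_L X Y L Gx Gy xs ys" using q by (rule order_trans)
  assume "P_L X Y L Gx Gy xs ys = ereal p"
  then have "?q \<le> p" using q by simp
  then have "Gy (x_hat X L y) y \<bullet> (ys - y) \<le> p * sqrt (L xs ys - L xs y)"
    using pos by (simp add: pos_divide_le_eq)
  then show "L xs ys - L (x_hat X L y) y \<le> p * sqrt (L xs ys - L xs y)"
    using fo le by linarith
qed

text \<open>Parallelogram identity for the two square roots.\<close>

lemma sqrt_add_sqrt_le_w:
  assumes "x \<in> X" "y \<in> Y"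
  shows "sqrt (L x ys - L xs ys) + sqrt (L xs ys - L xs y) \<le> sqrt (2 * w x y)"
proof (rule real_le_rsqrt)
  define a b where "a = sqrt (L x ys - L xs ys)" and "b = sqrt (L xs ys - L xs y)"
  have "a\<^sup>2 = L x ys - L xs ys" "b\<^sup>2 = L xs ys - L xs y"
    using assms saddle by (auto simp: a_def b_def)
  then have "2 * w x y = (a + b)\<^sup>2 + (a - b)\<^sup>2"
    by (simp add: wgap_def power2_eq_square algebra_simps)
  then show "(sqrt (L x ys - L xs ys) + sqrt (L xs ys - L xs y))\<^sup>2 \<le> 2 * w x y"
    by (simp flip: a_def b_def)
qed

text \<open>The gap h is split at the saddle value into a primal and a dual error, each bounded
  through P. Neither P nor its finiteness is known in advance, so the infinite case is treated
  too.\<close>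

lemma hgap_le_P:
  assumes "x \<in> X" "y \<in> Y" "w x y \<le> u" and nt: "X \<noteq> {xs} \<or> Y \<noteq> {ys}"
  shows "ereal (hgap X Y L x y) \<le> P_L X Y L Gx Gy xs ys * ereal (sqrt (2 * u))"
proof -
  have u: "0 \<le> u" using w_nonneg assms by fastforce
  have P: "0 \<le> P_L X Y L Gx Gy xs ys"
  proof (cases "X = {xs}")
    case True
    then show ?thesis using nt saddle P_Y_bound(1) by auto
  next
    case False
    then show ?thesis using saddle P_X_bound(1) by auto
  qed
  have hx: "L xs (y_hat Y L xs) = L xs ys" and hy: "L (x_hat X L ys) ys = L xs ys"
    using y_hat[OF saddle(1)] x_hat[OF saddle(2)] saddle by (auto intro: order_antisym)
  show ?thesis
  proof (cases "P_L X Y L Gx Gy xs ys")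
    case (real p)
    then have p: "0 \<le> p" using P by simp
    have "L x (y_hat Y L x) - L xs ys \<le> p * sqrt (L x ys - L xs ys)"
      using P_X_bound(2)[OF assms(1) _ real] hx by (cases "x = xs") auto
    moreover have "L xs ys - L (x_hat X L y) y \<le> p * sqrt (L xs ys - L xs y)"
      using P_Y_bound(2)[OF assms(2) _ real] hy by (cases "y = ys") auto
    ultimately have "hgap X Y L x y \<le> p * (sqrt (L x ys - L xs ys) + sqrt (L xs ys - L xs y))"
      unfolding hgap_eq[OF assms(1,2)] by (simp add: distrib_left)
    also have "\<dots> \<le> p * sqrt (2 * w x y)"
      using p sqrt_add_sqrt_le_w assms by (intro mult_left_mono) auto
    also have "\<dots> \<le> p * sqrt (2 * u)"
      using p assms by (intro mult_left_mono) auto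
    finally show ?thesis using real by simp
  next
    case PInf
    show ?thesis
    \<comment> \<open>The product of \<infinity> and 0 is 0 for extended reals, so for u = 0 the gap
      must really vanish: w = 0 forces the point to be the saddle point.\<close>
    proof (cases "u = 0")
      case True
      then have "w x y = 0" using w_nonneg assms by fastforce
      then have "x = xs" "y = ys"
        using strict_x strict_y saddle assms(1,2) unfolding wgap_def by (smt (verit))+
      then show ?thesis
        using hgap_eq[OF assms(1,2)] hx hy True by (simp flip: zero_ereal_def)
    next
      case False
      then show ?thesis using u PInf by simp
    qed
  next
    case MInf
    then show ?thesis using P by simp
  qed
qed

section \<open>Finiteness and comparison of the constants\<close>

lemma curv_sum_le:
  assumes "y \<in> Y" "e \<in> curv_set (\<lambda>x. L x y) (\<lambda>x. Gx x y) X"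
    and "x \<in> X" "e' \<in> curv_set (\<lambda>y. - L x y) (\<lambda>y. - Gy x y) Y"
  shows "e + e' \<le> 2 * C"
proof -
  define S1 where "S1 = (SUP y\<in>Y. curvature (\<lambda>x. L x y) (\<lambda>x. Gx x y) X)"
  define S2 where "S2 = (SUP x\<in>X. curvature (\<lambda>y. - L x y) (\<lambda>y. - Gy x y) Y)"
  have "ereal e \<le> S1"
    unfolding S1_def curvature_def using assms by (intro SUP_upper2[of y] Sup_upper) auto
  moreover have "ereal e' \<le> S2"
    unfolding S2_def curvature_def using assms by (intro SUP_upper2[of x] Sup_upper) auto
  moreover have c: "curv_L X Y L Gx Gy = (S1 + S2) / 2"
    unfolding curv_L_def S1_def S2_def ..
  \<comment> \<open>Each supremum dominates a real number and so is not minus infinity; finiteness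
    of the sum then makes both finite.\<close>
  ultimately show ?thesis
    using curv_fin unfolding c by (cases S1; cases S2) auto
qed

text \<open>The displacement s = v. It makes each supremum nonnegative, so that 2C also bounds the
  curvature of one block alone.\<close>

lemma curv_set_0:
  assumes "z \<in> K"
  shows "0 \<in> curv_set f df K"
  using curv_setI[of z K z z 1 f df] assms by simp

lemma curv_x_le:
  assumes "y \<in> Y" "e \<in> curv_set (\<lambda>x. L x y) (\<lambda>x. Gx x y) X"
  shows "e \<le> 2 * C"
  using curv_sum_le[OF assms saddle(1) curv_set_0[OF saddle(2)]] by simp

lemma curv_y_le:
  assumes "x \<in> X" "e \<in> curv_set (\<lambda>y. - L x y) (\<lambda>y. - Gy x y) Y"
  shows "e \<le> 2 * C"
  using curv_sum_le[OF saddle(2) curv_set_0[OF saddle(1)] assms] by simp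

lemma C_nonneg: "0 \<le> C"
  using curv_x_le[OF saddle(2) curv_set_0[OF saddle(1)]] by simp

lemma mu_int_L_real:
  assumes "xs \<in> rel_interior X" "ys \<in> rel_interior Y" "0 < mu_int_L X Y L Gx Gy xs ys"
    and nt: "X \<noteq> {xs} \<or> Y \<noteq> {ys}"
  obtains \<mu> where "mu_int_L X Y L Gx Gy xs ys = ereal \<mu>" "0 < \<mu>" "\<mu> \<le> 2 * C"
    "\<And>y e. y \<in> Y \<Longrightarrow> e \<in> mu_int_set (\<lambda>x. L x y) (\<lambda>x. Gx x y) X xs \<Longrightarrow> \<mu> \<le> e"
    "\<And>x e. x \<in> X \<Longrightarrow> e \<in> mu_int_set (\<lambda>y. - L x y) (\<lambda>y. - Gy x y) Y ys \<Longrightarrow> \<mu> \<le> e"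
proof -
  have "\<exists>e \<in> (\<Union>y\<in>Y. mu_int_set (\<lambda>x. L x y) (\<lambda>x. Gx x y) X xs) \<union>
      (\<Union>x\<in>X. mu_int_set (\<lambda>y. - L x y) (\<lambda>y. - Gy x y) Y ys). e \<le> 2 * C"
    using nt
  proof
    assume "X \<noteq> {xs}"
    then obtain e where "e \<in> mu_int_set (\<lambda>x. L x ys) (\<lambda>x. Gx x ys) X xs"
        "e \<in> curv_set (\<lambda>x. L x ys) (\<lambda>x. Gx x ys) X"
      using mu_int_set_meets_curv_set[OF X(2,1) assms(1)] by blast
    then show ?thesis using curv_x_le saddle by blast
  next
    assume "Y \<noteq> {ys}"
    then obtain e where "e \<in> mu_int_set (\<lambda>y. - L xs y) (\<lambda>y. - Gy xs y) Y ys"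
        "e \<in> curv_set (\<lambda>y. - L xs y) (\<lambda>y. - Gy xs y) Y"
      using mu_int_set_meets_curv_set[OF Y(2,1) assms(2)] by blast
    then show ?thesis using curv_y_le saddle by blast
  qed
  then obtain e where e: "e \<in> (\<Union>y\<in>Y. mu_int_set (\<lambda>x. L x y) (\<lambda>x. Gx x y) X xs) \<union>
      (\<Union>x\<in>X. mu_int_set (\<lambda>y. - L x y) (\<lambda>y. - Gy x y) Y ys)" "e \<le> 2 * C" ..
  show ?thesis
    by (rule min_INF_Inf_ereal[OF mu_int_L_def[unfolded mu_int_def] assms(3) e]) (rule that; blast)
qed

lemma mu_A_L_real:
  assumes A: "finite A" "X = convex hull A" and B: "finite B" "Y = convex hull B"
    and pos: "0 < mu_A_L X Y A B L Gx Gy"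
    and nt: "X \<noteq> {xs} \<or> Y \<noteq> {ys}"
  obtains \<mu> where "mu_A_L X Y A B L Gx Gy = ereal \<mu>" "0 < \<mu>" "\<mu> \<le> 2 * C"
    "\<And>y e. y \<in> Y \<Longrightarrow> e \<in> mu_A_set (\<lambda>x. L x y) (\<lambda>x. Gx x y) A \<Longrightarrow> \<mu> \<le> e"
    "\<And>x e. x \<in> X \<Longrightarrow> e \<in> mu_A_set (\<lambda>y. - L x y) (\<lambda>y. - Gy x y) B \<Longrightarrow> \<mu> \<le> e"
proof -
  have "\<exists>e \<in> (\<Union>y\<in>Y. mu_A_set (\<lambda>x. L x y) (\<lambda>x. Gx x y) A) \<union>
      (\<Union>x\<in>X. mu_A_set (\<lambda>y. - L x y) (\<lambda>y. - Gy x y) B). e \<le> 2 * C"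
    using nt
  proof
    assume "X \<noteq> {xs}"
    then obtain x where x: "x \<in> X" "x \<noteq> xs" using saddle by blast
    \<comment> \<open>Strict optimality of xs for y = ys provides the descent direction from which a
      pairwise displacement is built.\<close>
    have "Gx x ys \<bullet> (xs - x) < 0"
      using first_order_x[OF x(1) saddle(1,2)] strict_x[OF x] by linarith
    then obtain e where "e \<in> mu_A_set (\<lambda>x. L x ys) (\<lambda>x. Gx x ys) A"
        "e \<in> curv_set (\<lambda>x. L x ys) (\<lambda>x. Gx x ys) X"
      using mu_A_set_meets_curv_set[OF A(1), of x xs "\<lambda>x. Gx x ys" "\<lambda>x. L x ys"] x saddle A(2) by blast
    then show ?thesis using curv_x_le saddle by blast
  next
    assume "Y \<noteq> {ys}"
    then obtain y where y: "y \<in> Y" "y \<noteq> ys" using saddle by blast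
    have "(- Gy xs y) \<bullet> (ys - y) < 0"
      using first_order_y[OF saddle(1) y(1) saddle(2)] strict_y[OF y] by linarith
    then obtain e where "e \<in> mu_A_set (\<lambda>y. - L xs y) (\<lambda>y. - Gy xs y) B"
        "e \<in> curv_set (\<lambda>y. - L xs y) (\<lambda>y. - Gy xs y) Y"
      using mu_A_set_meets_curv_set[OF B(1), of y ys "\<lambda>y. - Gy xs y" "\<lambda>y. - L xs y"] y saddle B(2) by blast
    then show ?thesis using curv_y_le saddle by blast
  qed
  then obtain e where e: "e \<in> (\<Union>y\<in>Y. mu_A_set (\<lambda>x. L x y) (\<lambda>x. Gx x y) A) \<union>
      (\<Union>x\<in>X. mu_A_set (\<lambda>y. - L x y) (\<lambda>y. - Gy x y) B)" "e \<le> 2 * C" ..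
  show ?thesis
    by (rule min_INF_Inf_ereal[OF mu_A_L_def[unfolded mu_A_def] pos e]) (rule that; blast)
qed

text \<open>The choice s = v puts 0 into one of the two sets, so M is nonnegative, and positivity of
  \<nu> excludes an infinite M.\<close>

lemma nu_real:
  assumes nt: "X \<noteq> {xs} \<or> Y \<noteq> {ys}" and \<mu>: "0 < \<mu>"
    and pos: "0 < ereal \<theta> - M_L X Y L Gx Gy xs ys / ereal (sqrt \<mu>)"
  obtains M where "ereal \<theta> - M_L X Y L Gx Gy xs ys / ereal (sqrt \<mu>) = ereal (\<theta> - M / sqrt \<mu>)" "0 \<le> M"
    "\<And>e. e \<in> M_XY_set X Y L Gx xs ys \<Longrightarrow> e \<le> M" "\<And>e. e \<in> M_YX_set X Y L Gy xs ys \<Longrightarrow> e \<le> M"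
proof -
  have XY: "ereal e \<le> M_L X Y L Gx Gy xs ys" if "e \<in> M_XY_set X Y L Gx xs ys" for e
    unfolding M_L_def using that by (intro max.coboundedI1 Sup_upper) auto
  have YX: "ereal e \<le> M_L X Y L Gx Gy xs ys" if "e \<in> M_YX_set X Y L Gy xs ys" for e
    unfolding M_L_def using that by (intro max.coboundedI2 Sup_upper) auto
  have "0 \<in> M_XY_set X Y L Gx xs ys \<or> 0 \<in> M_YX_set X Y L Gy xs ys"
  proof (cases "X = {xs}")
    case False
    then obtain x where "x \<in> X" "x \<noteq> xs" using saddle by blast
    then have "(ys - ys) \<bullet> ((1 / sqrt (L x ys - L xs ys)) *\<^sub>R (Gy x ys - Gy xs ys)) \<in> M_YX_set X Y L Gy xs ys"
      unfolding M_YX_set_def using saddle(2) by blast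
    then show ?thesis by simp
  next
    case True
    then obtain y where "y \<in> Y" "y \<noteq> ys" using saddle nt by blast
    then have "(xs - xs) \<bullet> ((1 / sqrt (L xs ys - L xs y)) *\<^sub>R (Gx xs ys - Gx xs y)) \<in> M_XY_set X Y L Gx xs ys"
      unfolding M_XY_set_def using saddle(1) by blast
    then show ?thesis by simp
  qed
  then have M0: "0 \<le> M_L X Y L Gx Gy xs ys"
    using XY YX by (auto simp: zero_ereal_def)
  show ?thesis
  proof (cases "M_L X Y L Gx Gy xs ys")
    case (real M)
    show ?thesis by (rule that[of M]) (use real M0 XY YX \<mu> in auto)
  next
    case PInf
    then show ?thesis using pos \<mu> by simp
  next
    case MInf
    then show ?thesis using M0 by simp
  qed
qed

end

section \<open>Rates of convergence\<close>

lemma spfw_in: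
  assumes "convex X" "convex Y"
    and run: "spfw_run X Y Gx Gy \<eta> x y g" and \<eta>: "0 \<le> \<eta>"
  shows "x t \<in> X \<and> y t \<in> Y"
proof (induction t)
  case 0
  then show ?case using run by (simp add: spfw_run_def)
next
  case (Suc t)
  obtain sx sy \<gamma> where s: "sx \<in> X" "sy \<in> Y" "\<forall>u\<in>X. Gx (x t) (y t) \<bullet> sx \<le> Gx (x t) (y t) \<bullet> u"
    "\<forall>u\<in>Y. - Gy (x t) (y t) \<bullet> sy \<le> - Gy (x t) (y t) \<bullet> u"
    and g: "g t = (x t - sx) \<bullet> Gx (x t) (y t) + (y t - sy) \<bullet> - Gy (x t) (y t)"
    and \<gamma>: "\<gamma> = min 1 (\<eta> * g t)"
    and up: "x (Suc t) = (1 - \<gamma>) *\<^sub>R x t + \<gamma> *\<^sub>R sx" "y (Suc t) = (1 - \<gamma>) *\<^sub>R y t + \<gamma> *\<^sub>R sy"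
    using run[unfolded spfw_run_def Let_def, THEN conjunct2, THEN conjunct2, rule_format, of t] by blast
  have "0 \<le> (x t - sx) \<bullet> Gx (x t) (y t)" "0 \<le> (y t - sy) \<bullet> - Gy (x t) (y t)"
    using s(3,4) Suc by (auto simp: inner_diff_left inner_commute[of "Gx _ _"] inner_commute[of "Gy _ _"])
  then have "0 \<le> g t" using g by linarith
  then have "0 \<le> \<gamma>" "\<gamma> \<le> 1" using \<gamma> \<eta> by auto
  then show ?case
    unfolding up using assms(1,2) Suc s(1,2) by (auto intro!: convexD)
qed

text \<open>Common setting of both algorithms, with all constants real. \<theta> - \<nu> is the
  share of the gap lost by exchanging gradients at the saddle point for those at the
  iterate.\<close>

locale saddle_rate = saddle_problem +
  fixes \<mu> \<nu> \<theta> M :: real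
  assumes \<mu>: "0 < \<mu>" "\<mu> \<le> 2 * C"
    and \<nu>: "0 < \<nu>" "\<nu> = \<theta> - M / sqrt \<mu>" and M: "0 \<le> M" and \<theta>: "\<theta> \<le> 1"
    and M_XY: "\<And>e. e \<in> M_XY_set X Y L Gx xs ys \<Longrightarrow> e \<le> M"
    and M_YX: "\<And>e. e \<in> M_YX_set X Y L Gy xs ys \<Longrightarrow> e \<le> M"
begin

abbreviation "\<rho> \<equiv> \<nu>\<^sup>2 * \<mu> / (2 * C)"

abbreviation "gap_bound b \<equiv> 2 * max (sqrt C) (sqrt b) / \<nu> * sqrt b"

lemma C_pos: "0 < C"
  using \<mu> by linarith

lemma nu_le_theta: "\<nu> \<le> \<theta>"
proof -
  have "0 \<le> M / sqrt \<mu>" using M \<mu> by simp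
  then show ?thesis using \<nu>(2) by linarith
qed

lemma rho_unit: "0 \<le> 1 - \<rho>" "1 - \<rho> \<le> 1"
  using rho_bounds[of \<nu> \<mu> C] \<mu> \<nu>(1) nu_le_theta \<theta> by linarith+

lemma gap_bound_mono: "0 \<le> a \<Longrightarrow> a \<le> b \<Longrightarrow> gap_bound a \<le> gap_bound b"
  using \<nu>(1) C_pos by (intro mult_mono divide_right_mono mult_left_mono max.mono) (auto simp: le_max_iff_disj)

lemma bilinear_x:
  assumes "x \<in> X" "y \<in> Y" "a \<in> X" "b \<in> X"
  shows "(a - b) \<bullet> (Gx x ys - Gx x y) \<le> M * sqrt (L xs ys - L xs y)"
proof (cases "y = ys")
  case False
  have "(a - b) \<bullet> ((1 / sqrt (L xs ys - L xs y)) *\<^sub>R (Gx x ys - Gx x y)) \<in> M_XY_set X Y L Gx xs ys"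
    unfolding M_XY_set_def using assms False by blast
  from M_XY[OF this] show ?thesis
    using strict_y[OF assms(2) False] by (simp add: pos_divide_le_eq)
qed simp

lemma bilinear_y:
  assumes "x \<in> X" "y \<in> Y" "a \<in> Y" "b \<in> Y"
  shows "(a - b) \<bullet> (Gy x y - Gy xs y) \<le> M * sqrt (L x ys - L xs ys)"
proof (cases "x = xs")
  case False
  have "(a - b) \<bullet> ((1 / sqrt (L x ys - L xs ys)) *\<^sub>R (Gy x y - Gy xs y)) \<in> M_YX_set X Y L Gy xs ys"
    unfolding M_YX_set_def using assms False by blast
  from M_YX[OF this] show ?thesis
    using strict_x[OF assms(1) False] by (simp add: pos_divide_le_eq)
qed simp

text \<open>Curvature is applied along x at y = ys and along y at x = xs, since these two functions
  make up w. The algorithm sees other gradients; the discrepancy is M times a sum of roots, at most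
  (\<theta> - \<nu>) g. A slope of \<kappa> g thus leaves \<kappa> - \<theta> + \<nu>: this is \<nu>
  for \<kappa> = \<theta> and 1/2 + \<nu> for the first step of SP-AFW.\<close>

lemma descent:
  assumes in_X: "x \<in> X" "x' \<in> X" "a \<in> X" "b \<in> X" and in_Y: "y \<in> Y" "y' \<in> Y" "c \<in> Y" "d \<in> Y"
    and step: "x' = x + \<delta> *\<^sub>R (a - b)" "y' = y + \<delta> *\<^sub>R (c - d)" "0 \<le> \<delta>"
    and gap: "w x y \<le> \<beta> * g - \<beta>\<^sup>2 * \<mu> / 2" "0 \<le> g"
    and slope: "\<kappa> * g \<le> - ((a - b) \<bullet> Gx x y + (c - d) \<bullet> (- Gy x y))"
  shows "w x' y' \<le> w x y - \<delta> * (\<kappa> - \<theta> + \<nu>) * g + \<delta>\<^sup>2 * C"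
proof (cases "\<delta> = 0")
  case True
  then show ?thesis using step by simp
next
  case False
  then have \<delta>: "0 < \<delta>" using step by simp
  define e where "e = L x' ys - L x ys - \<delta> * ((a - b) \<bullet> Gx x ys)"
  define e' where "e' = - L xs y' - - L xs y - \<delta> * ((c - d) \<bullet> (- Gy xs y))"
  have "2 / \<delta>\<^sup>2 * e \<in> curv_set (\<lambda>x. L x ys) (\<lambda>x. Gx x ys) X"
    unfolding e_def using in_X \<delta> unfolding step(1) by (intro curv_setI)
  moreover have "2 / \<delta>\<^sup>2 * e' \<in> curv_set (\<lambda>y. - L xs y) (\<lambda>y. - Gy xs y) Y"
    unfolding e'_def using in_Y \<delta> unfolding step(2)
    by (intro curv_setI[where f = "\<lambda>y. - L xs y" and df = "\<lambda>y. - Gy xs y"])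
  \<comment> \<open>The two errors are bounded jointly; bounding each by 2C would double the
    quadratic term.\<close>
  ultimately have "2 / \<delta>\<^sup>2 * e + 2 / \<delta>\<^sup>2 * e' \<le> 2 * C"
    using curv_sum_le saddle by blast
  then have ee: "e + e' \<le> \<delta>\<^sup>2 * C"
    using \<delta> by (simp add: field_simps)
  have "(a - b) \<bullet> (Gx x ys - Gx x y) + (c - d) \<bullet> (Gy x y - Gy xs y)
      \<le> M * (sqrt (L x ys - L xs ys) + sqrt (L xs ys - L xs y))"
    using bilinear_x[of x y a b] bilinear_y[of x y c d] in_X in_Y by (simp add: distrib_left)
  also have "\<dots> \<le> M * sqrt (2 * w x y)"
    using sqrt_add_sqrt_le_w in_X in_Y M by (intro mult_left_mono) auto
  also have "\<dots> \<le> M * (g / sqrt \<mu>)"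
  proof (rule mult_left_mono[OF _ M])
    have "2 * w x y \<le> (g / sqrt \<mu>)\<^sup>2"
      using gap_le_square[OF gap(1) \<mu>(1)] \<mu> by (simp add: power_divide field_simps)
    then show "sqrt (2 * w x y) \<le> g / sqrt \<mu>"
      using gap(2) \<mu> by (intro real_le_lsqrt) auto
  qed
  also have "\<dots> = (\<theta> - \<nu>) * g" using \<nu>(2) by simp
  finally have "(a - b) \<bullet> Gx x ys + (c - d) \<bullet> (- Gy xs y)
      \<le> (\<theta> - \<nu>) * g + ((a - b) \<bullet> Gx x y + (c - d) \<bullet> (- Gy x y))"
    by (simp add: inner_diff_right)
  also have "\<dots> \<le> - ((\<kappa> - \<theta> + \<nu>) * g)" using slope by (simp add: algebra_simps)
  finally have "\<delta> * ((a - b) \<bullet> Gx x ys + (c - d) \<bullet> (- Gy xs y)) \<le> \<delta> * - ((\<kappa> - \<theta> + \<nu>) * g)"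
    using \<delta> by (intro mult_left_mono) auto
  moreover have "w x' y' = w x y + e + e' + \<delta> * ((a - b) \<bullet> Gx x ys + (c - d) \<bullet> (- Gy xs y))"
    unfolding wgap_def e_def e'_def distrib_left by linarith
  ultimately show ?thesis using ee by (simp add: mult.assoc)
qed

lemma step_length_cases:
  assumes "\<delta> = \<nu> / (2 * C) * g \<or> \<delta> = 1 \<and> 1 \<le> \<nu> / (2 * C) * g"
  shows "\<delta> = \<nu> * g / (2 * C) \<or> \<delta> = 1 \<and> 2 * C \<le> \<nu> * g"
  using assms C_pos by (auto simp: field_simps)

lemma good_step:
  assumes w: "0 \<le> w'" "0 \<le> w0" "w' \<le> w0 - \<delta> * \<nu> * g + \<delta>\<^sup>2 * C"
    and gap: "\<exists>\<beta>. 0 \<le> \<beta> \<and> \<beta> \<le> 1 \<and> w0 \<le> \<beta> * g - \<beta>\<^sup>2 * \<mu> / 2" "0 \<le> g"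
    and \<delta>: "\<delta> = \<nu> / (2 * C) * g \<or> \<delta> = 1 \<and> 1 \<le> \<nu> / (2 * C) * g"
  shows "w' \<le> (1 - \<rho>) * w0" "g \<le> gap_bound w0"
  using good_step_decrease[OF w(3) gap(1) step_length_cases[OF \<delta>] \<nu>(1) _ \<mu> gap(2)] nu_le_theta \<theta>
    good_step_gap[OF w(1,3) step_length_cases[OF \<delta>] \<nu>(1) C_pos w(2)] by auto

lemma fw_rate:
  assumes int: "xs \<in> rel_interior X" "ys \<in> rel_interior Y" and \<theta>1: "\<theta> = 1"
    and \<mu>x: "\<And>y e. y \<in> Y \<Longrightarrow> e \<in> mu_int_set (\<lambda>x. L x y) (\<lambda>x. Gx x y) X xs \<Longrightarrow> \<mu> \<le> e"
    and \<mu>y: "\<And>x e. x \<in> X \<Longrightarrow> e \<in> mu_int_set (\<lambda>y. - L x y) (\<lambda>y. - Gy x y) Y ys \<Longrightarrow> \<mu> \<le> e"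
    and run: "spfw_run X Y Gx Gy (\<nu> / (2 * C)) x y g"
  shows "x t \<in> X \<and> y t \<in> Y" "w (x t) (y t) \<le> w (x 0) (y 0) * (1 - \<rho>) ^ t"
    "Min (g ` {..T}) \<le> gap_bound (w (x 0) (y 0) * (1 - \<rho>) ^ T)"
proof -
  have "0 \<le> \<nu> / (2 * C)" using \<nu>(1) C_pos by simp
  then have XY: "x t \<in> X" "y t \<in> Y" for t
    using spfw_in[OF X(1) Y(1) run] by auto
  then show "x t \<in> X \<and> y t \<in> Y" by simp
  have step: "w (x (Suc t)) (y (Suc t)) \<le> (1 - \<rho>) * w (x t) (y t) \<and> g t \<le> gap_bound (w (x t) (y t))" for t
  proof -
    let ?rx = "Gx (x t) (y t)" and ?ry = "- Gy (x t) (y t)"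
    obtain sx sy \<gamma> where s: "sx \<in> X" "sy \<in> Y" "\<forall>u\<in>X. ?rx \<bullet> sx \<le> ?rx \<bullet> u" "\<forall>u\<in>Y. ?ry \<bullet> sy \<le> ?ry \<bullet> u"
      and g: "g t = (x t - sx) \<bullet> ?rx + (y t - sy) \<bullet> ?ry"
      and \<gamma>: "\<gamma> = min 1 (\<nu> / (2 * C) * g t)"
      and up: "x (Suc t) = (1 - \<gamma>) *\<^sub>R x t + \<gamma> *\<^sub>R sx" "y (Suc t) = (1 - \<gamma>) *\<^sub>R y t + \<gamma> *\<^sub>R sy"
      using run[unfolded spfw_run_def Let_def, THEN conjunct2, THEN conjunct2, rule_format, of t] by blast
    define gx gy where "gx = ?rx \<bullet> (x t - sx)" and "gy = ?ry \<bullet> (y t - sy)"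
    have gxy: "g t = gx + gy" "0 \<le> gx" "0 \<le> gy"
      using s(3)[rule_format, OF XY(1)] s(4)[rule_format, OF XY(2)]
      by (simp add: g gx_def gy_def inner_commute, simp_all add: gx_def gy_def inner_diff_right)
    have "\<exists>\<beta>. 0 \<le> \<beta> \<and> \<beta> \<le> 1 \<and> L (x t) (y t) - L xs (y t) \<le> \<beta> * gx - \<beta>\<^sup>2 * \<mu> / 2"
      unfolding gx_def
      by (rule mu_int_gap[where f = "\<lambda>x. L x (y t)" and df = "\<lambda>x. Gx x (y t)" and xc = xs and K = X])
        (use X int XY \<mu>x s in auto)
    moreover have "\<exists>\<beta>. 0 \<le> \<beta> \<and> \<beta> \<le> 1 \<and> - L (x t) (y t) - - L (x t) ys \<le> \<beta> * gy - \<beta>\<^sup>2 * \<mu> / 2"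
      unfolding gy_def
      by (rule mu_int_gap[where f = "\<lambda>y. - L (x t) y" and df = "\<lambda>y. - Gy (x t) y" and xc = ys and K = Y])
        (use Y int XY \<mu>y s in auto)
    ultimately have gap: "\<exists>\<beta>. 0 \<le> \<beta> \<and> \<beta> \<le> 1 \<and> w (x t) (y t) \<le> \<beta> * g t - \<beta>\<^sup>2 * \<mu> / 2"
      using gap_add[OF _ _ gxy(2,3) \<mu>(1)] gxy(1) by (fastforce simp: wgap_def)
    then obtain \<beta> where \<beta>: "w (x t) (y t) \<le> \<beta> * g t - \<beta>\<^sup>2 * \<mu> / 2" by blast
    have g0: "0 \<le> g t" using gxy by simp
    have up': "x (Suc t) = x t + \<gamma> *\<^sub>R (sx - x t)" "y (Suc t) = y t + \<gamma> *\<^sub>R (sy - y t)"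
      using up by (simp_all add: algebra_simps)
    have \<gamma>0: "0 \<le> \<gamma>" using \<gamma> g0 \<nu>(1) C_pos by simp
    have sl: "1 * g t \<le> - ((sx - x t) \<bullet> ?rx + (sy - y t) \<bullet> ?ry)"
      by (simp add: g inner_diff_left)
    have "w (x (Suc t)) (y (Suc t)) \<le> w (x t) (y t) - \<gamma> * \<nu> * g t + \<gamma>\<^sup>2 * C"
      using descent[OF XY(1) XY(1) s(1) XY(1) XY(2) XY(2) s(2) XY(2) up' \<gamma>0 \<beta> g0 sl] \<theta>1 by simp
    from good_step[OF _ _ this gap g0] show ?thesis
      using w_nonneg XY \<gamma> by (simp add: min_def split: if_splits)
  qed
  have rate: "w (x t) (y t) \<le> w (x 0) (y 0) * (1 - \<rho>) ^ t" for t
  proof (induction t)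
    case (Suc t)
    have "(1 - \<rho>) * w (x t) (y t) \<le> (1 - \<rho>) * (w (x 0) (y 0) * (1 - \<rho>) ^ t)"
      using Suc rho_unit by (intro mult_left_mono) auto
    with step[of t] show ?case by (simp add: mult_ac)
  qed simp
  then show "w (x t) (y t) \<le> w (x 0) (y 0) * (1 - \<rho>) ^ t" .
  \<comment> \<open>Without drop steps the gap at time T itself satisfies the bound.\<close>
  have "Min (g ` {..T}) \<le> g T" by (intro Min_le) auto
  also have "\<dots> \<le> gap_bound (w (x T) (y T))" using step by simp
  also have "\<dots> \<le> gap_bound (w (x 0) (y 0) * (1 - \<rho>) ^ T)"
    using rate w_nonneg XY by (intro gap_bound_mono) auto
  finally show "Min (g ` {..T}) \<le> gap_bound (w (x 0) (y 0) * (1 - \<rho>) ^ T)" .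
qed

lemma afw_rate:
  assumes A: "finite A" "X = convex hull A" and B: "finite B" "Y = convex hull B" and \<theta>1: "\<theta> = 1/2"
    and \<mu>x: "\<And>y e. y \<in> Y \<Longrightarrow> e \<in> mu_A_set (\<lambda>x. L x y) (\<lambda>x. Gx x y) A \<Longrightarrow> \<mu> \<le> e"
    and \<mu>y: "\<And>x e. x \<in> X \<Longrightarrow> e \<in> mu_A_set (\<lambda>y. - L x y) (\<lambda>y. - Gy x y) B \<Longrightarrow> \<mu> \<le> e"
    and run: "spafw_run A B Gx Gy (\<nu> / (2 * C)) x y ax ay g isdrop"
  defines "k \<equiv> \<lambda>t. card {i. i < t \<and> \<not> isdrop i}"
  shows "x t \<in> X \<and> y t \<in> Y" "w (x t) (y t) \<le> w (x 0) (y 0) * (1 - \<rho>) ^ k t"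
    "Min (g ` {..T}) \<le> gap_bound (w (x 0) (y 0) * (1 - \<rho>) ^ k T)"
proof -
  have \<eta>: "0 \<le> \<nu> / (2 * C)" using \<nu>(1) C_pos by simp
  have W: "weights_on A (x t) (ax t)" "weights_on B (y t) (ay t)" for t
    using spafw_weights[OF run A(1) B(1) \<eta>] by auto
  have XY: "x t \<in> X" "y t \<in> Y" for t
    using weights_on_hull[OF A(1) W(1)] weights_on_hull[OF B(1) W(2)] A(2) B(2) by auto
  then show "x t \<in> X \<and> y t \<in> Y" by simp
  have w0: "0 \<le> w (x t) (y t)" for t using w_nonneg XY by simp
  have step: "w (x (Suc t)) (y (Suc t)) \<le> w (x t) (y t)
    \<and> (\<not> isdrop t \<longrightarrow> w (x (Suc t)) (y (Suc t)) \<le> (1 - \<rho>) * w (x t) (y t) \<and> g t \<le> gap_bound (w (x t) (y t)))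
    \<and> (t = 0 \<longrightarrow> \<not> isdrop t \<and> w (x (Suc t)) (y (Suc t)) \<le> (1 - \<rho>)\<^sup>2 * w (x t) (y t)
          \<and> g t \<le> gap_bound ((1 - \<rho>) * w (x t) (y t)))" for t
  proof -
    let ?rx = "Gx (x t) (y t)" and ?ry = "- Gy (x t) (y t)"
    let ?Sx = "{v\<in>A. 0 < ax t v}" and ?Sy = "{v\<in>B. 0 < ay t v}"
    obtain sx sy vx vy a b c d \<gamma> where
      s: "sx \<in> A" "\<And>u. u \<in> A \<Longrightarrow> ?rx \<bullet> sx \<le> ?rx \<bullet> u" "sy \<in> B" "\<And>u. u \<in> B \<Longrightarrow> ?ry \<bullet> sy \<le> ?ry \<bullet> u" and
      v: "vx \<in> ?Sx" "\<And>u. u \<in> ?Sx \<Longrightarrow> ?rx \<bullet> u \<le> ?rx \<bullet> vx" "vy \<in> ?Sy" "\<And>u. u \<in> ?Sy \<Longrightarrow> ?ry \<bullet> u \<le> ?ry \<bullet> vy" and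
      g: "g t = ?rx \<bullet> (vx - sx) + ?ry \<bullet> (vy - sy)" "0 \<le> ?rx \<bullet> (vx - sx)" "0 \<le> ?ry \<bullet> (vy - sy)" and
      abcd: "a \<in> convex hull A" "b \<in> convex hull A" "c \<in> convex hull B" "d \<in> convex hull B" and
      up: "x (Suc t) = x t + \<gamma> *\<^sub>R (a - b)" "y (Suc t) = y t + \<gamma> *\<^sub>R (c - d)" and
      \<gamma>: "0 \<le> \<gamma>" "\<gamma> \<le> \<nu> / (2 * C) * g t"
        "\<not> isdrop t \<Longrightarrow> \<gamma> = \<nu> / (2 * C) * g t \<or> \<gamma> = 1 \<and> 1 \<le> \<nu> / (2 * C) * g t" and
      sl: "g t / 2 \<le> - ((a - b) \<bullet> ?rx + (c - d) \<bullet> ?ry)" and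
      sl0: "vx = x t \<Longrightarrow> vy = y t \<Longrightarrow> g t \<le> - ((a - b) \<bullet> ?rx + (c - d) \<bullet> ?ry) \<and> \<not> isdrop t"
      by (rule spafw_step[OF run A(1) B(1) \<eta> W]) blast
    note hull = abcd[folded A(2) B(2)]
    have "\<exists>\<beta>. 0 \<le> \<beta> \<and> \<beta> \<le> 1 \<and> L (x t) (y t) - L xs (y t) \<le> \<beta> * (?rx \<bullet> (vx - sx)) - \<beta>\<^sup>2 * \<mu> / 2"
      by (rule mu_A_gap[where f = "\<lambda>x. L x (y t)" and df = "\<lambda>x. Gx x (y t)",
            OF A(1) weights_on_conv_reps[OF A(1) W(1)[of t]] saddle(1)[unfolded A(2)]
              first_order_x[OF XY(1) saddle(1) XY(2)] \<mu>x[OF XY(2)] s(1,2) v(1,2)])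
    moreover have "\<exists>\<beta>. 0 \<le> \<beta> \<and> \<beta> \<le> 1 \<and>
        - L (x t) (y t) - - L (x t) ys \<le> \<beta> * (?ry \<bullet> (vy - sy)) - \<beta>\<^sup>2 * \<mu> / 2"
      by (rule mu_A_gap[where f = "\<lambda>y. - L (x t) y" and df = "\<lambda>y. - Gy (x t) y",
            OF B(1) weights_on_conv_reps[OF B(1) W(2)[of t]] saddle(2)[unfolded B(2)]
              first_order_y[OF XY(1) XY(2) saddle(2)] \<mu>y[OF XY(1)] s(3,4) v(3,4)])
    ultimately have gap: "\<exists>\<beta>. 0 \<le> \<beta> \<and> \<beta> \<le> 1 \<and> w (x t) (y t) \<le> \<beta> * g t - \<beta>\<^sup>2 * \<mu> / 2"
      using gap_add[OF _ _ g(2,3) \<mu>(1)] g(1) by (fastforce simp: wgap_def)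
    then obtain \<beta> where \<beta>: "w (x t) (y t) \<le> \<beta> * g t - \<beta>\<^sup>2 * \<mu> / 2" by blast
    have g0: "0 \<le> g t" using g by simp
    note desc = descent[OF XY(1) XY(1) hull(1,2) XY(2) XY(2) hull(3,4) up \<gamma>(1) \<beta> g0]
    have d1: "w (x (Suc t)) (y (Suc t)) \<le> w (x t) (y t) - \<gamma> * \<nu> * g t + \<gamma>\<^sup>2 * C"
      using desc[of "1/2"] sl \<theta>1 by simp
    have "w (x (Suc t)) (y (Suc t)) \<le> w (x t) (y t)"
      using drop_step_nonincreasing[OF d1 \<gamma>(1) _ C_pos] \<gamma>(2) by simp
    moreover have "w (x (Suc t)) (y (Suc t)) \<le> (1 - \<rho>) * w (x t) (y t) \<and> g t \<le> gap_bound (w (x t) (y t))"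
      if "\<not> isdrop t"
      using good_step[OF w0 w0 d1 gap g0 \<gamma>(3)[OF that]] by simp
    moreover have "\<not> isdrop t \<and> w (x (Suc t)) (y (Suc t)) \<le> (1 - \<rho>)\<^sup>2 * w (x t) (y t)
          \<and> g t \<le> gap_bound ((1 - \<rho>) * w (x t) (y t))" if t: "t = 0"
    proof -
      \<comment> \<open>The initial weights are indicator functions, so the only possible away
        vertices are the starting points.\<close>
      have "vx = x t" "vy = y t"
        using v(1,3) run unfolding t spafw_run_def by (auto split: if_splits)
      then have f: "1 * g t \<le> - ((a - b) \<bullet> ?rx + (c - d) \<bullet> ?ry)" "\<not> isdrop t"
        using sl0 by auto
      have d2: "w (x (Suc t)) (y (Suc t)) \<le> w (x t) (y t) - \<gamma> * (1/2 + \<nu>) * g t + \<gamma>\<^sup>2 * C"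
        using desc[OF f(1)] \<theta>1 by simp
      show ?thesis
        using first_step[OF w0 d2 gap step_length_cases[OF \<gamma>(3)[OF f(2)]] \<nu>(1) _ \<mu> g0 w0]
          nu_le_theta \<theta>1 f(2) by auto
    qed
    ultimately show ?thesis by blast
  qed
  note seq = linear_rate_with_drops[where w = "\<lambda>t. w (x t) (y t)" and g = g and drop = isdrop
      and r = "1 - \<rho>" and F = "\<lambda>b. gap_bound b", OF w0 rho_unit gap_bound_mono]
  have *: "\<not> isdrop 0" "w (x 1) (y 1) \<le> (1 - \<rho>)\<^sup>2 * w (x 0) (y 0)" "g 0 \<le> gap_bound ((1 - \<rho>) * w (x 0) (y 0))"
    using step[of 0] by auto
  show "w (x t) (y t) \<le> w (x 0) (y 0) * (1 - \<rho>) ^ k t"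
    unfolding k_def by (rule seq(1)[OF _ _ *]) (use step in auto)
  show "Min (g ` {..T}) \<le> gap_bound (w (x 0) (y 0) * (1 - \<rho>) ^ k T)"
    unfolding k_def by (rule seq(2)[OF _ _ *]) (use step in auto)
qed

end

section \<open>Singleton domains and assembly of both cases\<close>

context saddle_problem
begin

text \<open>If both domains are singletons, the sets behind the strong convexity constant, M and P
  are empty, so the former is \<infinity> and the latter two are minus infinity. The claims then
  rest on h, w and g being 0.\<close>

lemma singleton_gaps:
  assumes "X = {xs}" "Y = {ys}" "x \<in> X" "y \<in> Y"
  shows "hgap X Y L x y = 0" "w x y = 0"
  using assms by (auto simp: hgap_def wgap_def)

lemma spfw_singleton_gap:
  assumes "X = {xs}" "Y = {ys}" and run: "spfw_run X Y Gx Gy \<eta> x y g" and "0 \<le> \<eta>"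
  shows "g t = 0"
proof -
  have "x t = xs" "y t = ys"
    using spfw_in[OF X(1) Y(1) run assms(4), of t] assms(1,2) by auto
  moreover obtain sx sy where "sx \<in> X" "sy \<in> Y"
    "g t = (x t - sx) \<bullet> Gx (x t) (y t) + (y t - sy) \<bullet> - Gy (x t) (y t)"
    using run[unfolded spfw_run_def Let_def, THEN conjunct2, THEN conjunct2, rule_format, of t] by blast
  ultimately show ?thesis using assms(1,2) by simp
qed

lemma spafw_singleton_gap:
  assumes A: "finite A" "X = convex hull A" and B: "finite B" "Y = convex hull B"
    and sing: "X = {xs}" "Y = {ys}" and run: "spafw_run A B Gx Gy \<eta> x y ax ay g isdrop" and \<eta>: "0 \<le> \<eta>"
  shows "g t = 0"
proof -
  have AB: "A \<subseteq> {xs}" "B \<subseteq> {ys}"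
    using A(2) B(2) sing hull_subset[of A convex] hull_subset[of B convex] by auto
  note W = spafw_weights[OF run A(1) B(1) \<eta>, of t]
  show ?thesis
  proof (rule spafw_step[OF run A(1) B(1) \<eta> W[THEN conjunct1] W[THEN conjunct2]])
    fix sx sy vx vy
    assume "sx \<in> A" "sy \<in> B" "vx \<in> {v\<in>A. 0 < ax t v}" "vy \<in> {v\<in>B. 0 < ay t v}"
      and g: "g t = Gx (x t) (y t) \<bullet> (vx - sx) + - Gy (x t) (y t) \<bullet> (vy - sy)"
    then have "sx = xs" "vx = xs" "sy = ys" "vy = ys" using AB by auto
    then show "g t = 0" using g by simp
  qed
qed

lemma spafw_in:
  assumes A: "finite A" "X = convex hull A" and B: "finite B" "Y = convex hull B"
    and run: "spafw_run A B Gx Gy \<eta> x y ax ay g isdrop" and \<eta>: "0 \<le> \<eta>"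
  shows "x t \<in> X \<and> y t \<in> Y"
  using spafw_weights[OF run A(1) B(1) \<eta>, of t] weights_on_hull[OF A(1)] weights_on_hull[OF B(1)]
  unfolding A(2) B(2) by blast

text \<open>In the degenerate case \<nu> may be infinite and C zero, so only a nonnegative step
  factor is claimed; this suffices to keep the iterates feasible.\<close>

lemma real_of_ereal_divide_nonneg: "0 < e \<Longrightarrow> 0 \<le> real_of_ereal e / (2 * C)"
  using C_nonneg by (simp add: real_of_ereal_pos)

lemma spfw_convergence:
  assumes int: "(xs, ys) \<in> rel_interior (X \<times> Y)" and pos: "0 < mu_int_L X Y L Gx Gy xs ys"
    and nu_pos: "0 < nu_FW X Y L Gx Gy xs ys"
  defines "\<nu> \<equiv> real_of_ereal (nu_FW X Y L Gx Gy xs ys)"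
  defines "r \<equiv> 1 - \<nu>\<^sup>2 * real_of_ereal (mu_int_L X Y L Gx Gy xs ys) / (2 * C)"
  assumes run: "spfw_run X Y Gx Gy (\<nu> / (2 * C)) x y g"
  shows "ereal (hgap X Y L (x t) (y t))
      \<le> P_L X Y L Gx Gy xs ys * ereal (sqrt (2 * w (x 0) (y 0)) * sqrt (r ^ t))"
    and "Min (g ` {..T}) \<le> 2 * max (sqrt C) (sqrt (w (x 0) (y 0)) * sqrt (r ^ T)) / \<nu>
      * (sqrt (w (x 0) (y 0)) * sqrt (r ^ T))"
proof -
  have \<eta>: "0 \<le> \<nu> / (2 * C)"
    unfolding \<nu>_def by (rule real_of_ereal_divide_nonneg[OF nu_pos])
  have XY: "x t \<in> X \<and> y t \<in> Y" for t
    by (rule spfw_in[OF X(1) Y(1) run \<eta>])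
  have "ereal (hgap X Y L (x t) (y t))
      \<le> P_L X Y L Gx Gy xs ys * ereal (sqrt (2 * w (x 0) (y 0)) * sqrt (r ^ t)) \<and>
    Min (g ` {..T}) \<le> 2 * max (sqrt C) (sqrt (w (x 0) (y 0)) * sqrt (r ^ T)) / \<nu>
      * (sqrt (w (x 0) (y 0)) * sqrt (r ^ T))"
  proof (cases "X = {xs} \<and> Y = {ys}")
    case True
    then have g: "g t = 0" for t
      using spfw_singleton_gap[OF _ _ run \<eta>] by blast
    have "g ` {..T} = {0}" using g by (auto simp: image_def)
    \<comment> \<open>As w is 0 at the start, both right-hand sides are products with 0, hence 0
      whatever P and \<nu> are.\<close>
    then show ?thesis
      using singleton_gaps True XY by (simp flip: zero_ereal_def)
  next
    case False
    then have nt: "X \<noteq> {xs} \<or> Y \<noteq> {ys}" by simp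
    have int': "xs \<in> rel_interior X" "ys \<in> rel_interior Y"
      using int X(1) Y(1) by (auto simp: rel_interior_Times)
    obtain \<mu> where mu: "mu_int_L X Y L Gx Gy xs ys = ereal \<mu>" and \<mu>: "0 < \<mu>" "\<mu> \<le> 2 * C"
      and \<mu>x: "\<And>y e. y \<in> Y \<Longrightarrow> e \<in> mu_int_set (\<lambda>x. L x y) (\<lambda>x. Gx x y) X xs \<Longrightarrow> \<mu> \<le> e"
      and \<mu>y: "\<And>x e. x \<in> X \<Longrightarrow> e \<in> mu_int_set (\<lambda>y. - L x y) (\<lambda>y. - Gy x y) Y ys \<Longrightarrow> \<mu> \<le> e"
      by (rule mu_int_L_real[OF int' pos nt]) blast
    have nu: "nu_FW X Y L Gx Gy xs ys = ereal 1 - M_L X Y L Gx Gy xs ys / ereal (sqrt \<mu>)"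
      by (simp add: nu_FW_def mu one_ereal_def)
    obtain M where M: "nu_FW X Y L Gx Gy xs ys = ereal (1 - M / sqrt \<mu>)" "0 \<le> M"
      "\<And>e. e \<in> M_XY_set X Y L Gx xs ys \<Longrightarrow> e \<le> M" "\<And>e. e \<in> M_YX_set X Y L Gy xs ys \<Longrightarrow> e \<le> M"
      by (rule nu_real[OF nt \<mu>(1) nu_pos[unfolded nu], folded nu]) blast
    have \<nu>: "\<nu> = 1 - M / sqrt \<mu>" "0 < \<nu>" using nu_pos by (auto simp: \<nu>_def M(1))
    interpret saddle_rate X Y L Gx Gy xs ys \<mu>X \<mu>Y \<mu> \<nu> 1 M
      by unfold_locales (use \<mu> \<nu> M in auto)
    have r: "r = 1 - \<rho>" by (simp add: r_def mu)
    note rate = fw_rate[OF int' refl \<mu>x \<mu>y run, folded r]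
    show ?thesis
      using hgap_le_P[OF _ _ rate(2) nt] XY rate(3)[where T = T] by (simp add: real_sqrt_mult mult.assoc)
  qed
  then show "ereal (hgap X Y L (x t) (y t))
      \<le> P_L X Y L Gx Gy xs ys * ereal (sqrt (2 * w (x 0) (y 0)) * sqrt (r ^ t))"
    and "Min (g ` {..T}) \<le> 2 * max (sqrt C) (sqrt (w (x 0) (y 0)) * sqrt (r ^ T)) / \<nu>
      * (sqrt (w (x 0) (y 0)) * sqrt (r ^ T))" by blast+
qed

lemma spafw_convergence:
  assumes A: "finite A" "X = convex hull A" and B: "finite B" "Y = convex hull B"
    and pos: "0 < mu_A_L X Y A B L Gx Gy" and nu_pos: "0 < nu_PFW X Y A B L Gx Gy xs ys"
  defines "\<nu> \<equiv> real_of_ereal (nu_PFW X Y A B L Gx Gy xs ys)"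
  defines "r \<equiv> 1 - \<nu>\<^sup>2 * real_of_ereal (mu_A_L X Y A B L Gx Gy) / (2 * C)"
  assumes run: "spafw_run A B Gx Gy (\<nu> / (2 * C)) x y ax ay g isdrop"
  defines "k \<equiv> \<lambda>t. card {i. i < t \<and> \<not> isdrop i}"
  shows "real t / 3 \<le> real (k t)"
    and "ereal (hgap X Y L (x t) (y t))
      \<le> P_L X Y L Gx Gy xs ys * ereal (sqrt (2 * w (x 0) (y 0)) * sqrt (r ^ k t))"
    and "Min (g ` {..T}) \<le> 2 * max (sqrt C) (sqrt (w (x 0) (y 0)) * sqrt (r ^ k T)) / \<nu>
      * (sqrt (w (x 0) (y 0)) * sqrt (r ^ k T))"
proof -
  have \<eta>: "0 \<le> \<nu> / (2 * C)"
    unfolding \<nu>_def by (rule real_of_ereal_divide_nonneg[OF nu_pos])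
  show "real t / 3 \<le> real (k t)"
    unfolding k_def by (rule spafw_good_steps[OF run A(1) B(1) \<eta>])
  have XY: "x t \<in> X \<and> y t \<in> Y" for t
    by (rule spafw_in[OF A B run \<eta>])
  have "ereal (hgap X Y L (x t) (y t))
      \<le> P_L X Y L Gx Gy xs ys * ereal (sqrt (2 * w (x 0) (y 0)) * sqrt (r ^ k t)) \<and>
    Min (g ` {..T}) \<le> 2 * max (sqrt C) (sqrt (w (x 0) (y 0)) * sqrt (r ^ k T)) / \<nu>
      * (sqrt (w (x 0) (y 0)) * sqrt (r ^ k T))"
  proof (cases "X = {xs} \<and> Y = {ys}")
    case True
    then have g: "g t = 0" for t
      using spafw_singleton_gap[OF A B _ _ run \<eta>] by blast
    have "g ` {..T} = {0}" using g by (auto simp: image_def)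
    then show ?thesis
      using singleton_gaps True XY by (simp flip: zero_ereal_def)
  next
    case False
    then have nt: "X \<noteq> {xs} \<or> Y \<noteq> {ys}" by simp
    obtain \<mu> where mu: "mu_A_L X Y A B L Gx Gy = ereal \<mu>" and \<mu>: "0 < \<mu>" "\<mu> \<le> 2 * C"
      and \<mu>x: "\<And>y e. y \<in> Y \<Longrightarrow> e \<in> mu_A_set (\<lambda>x. L x y) (\<lambda>x. Gx x y) A \<Longrightarrow> \<mu> \<le> e"
      and \<mu>y: "\<And>x e. x \<in> X \<Longrightarrow> e \<in> mu_A_set (\<lambda>y. - L x y) (\<lambda>y. - Gy x y) B \<Longrightarrow> \<mu> \<le> e"
      by (rule mu_A_L_real[OF A B pos nt]) blast
    have nu: "nu_PFW X Y A B L Gx Gy xs ys = ereal (1/2) - M_L X Y L Gx Gy xs ys / ereal (sqrt \<mu>)"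
      by (simp add: nu_PFW_def mu)
    obtain M where M: "nu_PFW X Y A B L Gx Gy xs ys = ereal (1/2 - M / sqrt \<mu>)" "0 \<le> M"
      "\<And>e. e \<in> M_XY_set X Y L Gx xs ys \<Longrightarrow> e \<le> M" "\<And>e. e \<in> M_YX_set X Y L Gy xs ys \<Longrightarrow> e \<le> M"
      by (rule nu_real[OF nt \<mu>(1) nu_pos[unfolded nu], folded nu]) blast
    have \<nu>: "\<nu> = 1/2 - M / sqrt \<mu>" "0 < \<nu>" using nu_pos by (auto simp: \<nu>_def M(1))
    interpret saddle_rate X Y L Gx Gy xs ys \<mu>X \<mu>Y \<mu> \<nu> "1/2" M
      by unfold_locales (use \<mu> \<nu> M in auto)
    have r: "r = 1 - \<rho>" by (simp add: r_def mu)
    note rate = afw_rate[OF A B refl \<mu>x \<mu>y run, folded r k_def]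
    show ?thesis
      using hgap_le_P[OF _ _ rate(2) nt] XY rate(3)[where T = T] by (simp add: real_sqrt_mult mult.assoc k_def)
  qed
  then show "ereal (hgap X Y L (x t) (y t))
      \<le> P_L X Y L Gx Gy xs ys * ereal (sqrt (2 * w (x 0) (y 0)) * sqrt (r ^ k t))"
    and "Min (g ` {..T}) \<le> 2 * max (sqrt C) (sqrt (w (x 0) (y 0)) * sqrt (r ^ k T)) / \<nu>
      * (sqrt (w (x 0) (y 0)) * sqrt (r ^ k T))" by blast+
qed

end

theorem theorem24:
  fixes X :: "'a::euclidean_space set" and Y :: "'b::euclidean_space set"
    and L :: "'a \<Rightarrow> 'b \<Rightarrow> real"
    and Gx :: "'a \<Rightarrow> 'b \<Rightarrow> 'a" and Gy :: "'a \<Rightarrow> 'b \<Rightarrow> 'b"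
    and xs :: 'a and ys :: 'b
  assumes X: "X \<noteq> {}" "convex X" "compact X"
    and Y: "Y \<noteq> {}" "convex Y" "compact Y"
    and diff: "\<forall>x\<in>X. \<forall>y\<in>Y. ((\<lambda>z. L (fst z) (snd z)) has_derivative
                 (\<lambda>h. Gx x y \<bullet> fst h + Gy x y \<bullet> snd h)) (at (x, y) within X \<times> Y)"
    and sc: "\<exists>\<mu>X>0. \<exists>\<mu>Y>0. (\<forall>y\<in>Y. strongly_convex_on X \<mu>X (\<lambda>x. L x y)) \<and>
                            (\<forall>x\<in>X. strongly_convex_on Y \<mu>Y (\<lambda>y. - L x y))"
    and saddle: "xs \<in> X" "ys \<in> Y" "\<forall>x\<in>X. \<forall>y\<in>Y. L xs y \<le> L xs ys \<and> L xs ys \<le> L x ys"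
    and curv_fin: "curv_L X Y L Gx Gy < \<infinity>"
  shows "let C = real_of_ereal (curv_L X Y L Gx Gy); P = P_L X Y L Gx Gy xs ys in
    ((xs, ys) \<in> rel_interior (X \<times> Y) \<and> 0 < mu_int_L X Y L Gx Gy xs ys \<and>
       0 < nu_FW X Y L Gx Gy xs ys \<longrightarrow>
      (let \<nu> = real_of_ereal (nu_FW X Y L Gx Gy xs ys);
           \<mu> = real_of_ereal (mu_int_L X Y L Gx Gy xs ys);
           \<rho> = \<nu>\<^sup>2 * \<mu> / (2 * C) in
       \<forall>x y g. spfw_run X Y Gx Gy (\<nu> / (2 * C)) x y g \<longrightarrow>
         (let w0 = wgap L xs ys (x 0) (y 0) in
          (\<forall>t. ereal (hgap X Y L (x t) (y t)) \<le> P * ereal (sqrt (2 * w0) * sqrt ((1 - \<rho>) ^ t))) \<and>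
          (\<forall>T. Min (g ` {..T}) \<le>
                 2 * max (sqrt C) (sqrt w0 * sqrt ((1 - \<rho>) ^ T)) / \<nu> * (sqrt w0 * sqrt ((1 - \<rho>) ^ T))))))
    \<and>
    (\<forall>A B. finite A \<and> finite B \<and> X = convex hull A \<and> Y = convex hull B \<and>
       0 < mu_A_L X Y A B L Gx Gy \<and> 0 < nu_PFW X Y A B L Gx Gy xs ys \<longrightarrow>
      (let \<nu> = real_of_ereal (nu_PFW X Y A B L Gx Gy xs ys);
           \<mu> = real_of_ereal (mu_A_L X Y A B L Gx Gy);
           \<rho> = \<nu>\<^sup>2 * \<mu> / (2 * C) in
       \<forall>x y ax ay g isdrop. spafw_run A B Gx Gy (\<nu> / (2 * C)) x y ax ay g isdrop \<longrightarrow>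
         (let w0 = wgap L xs ys (x 0) (y 0); k = (\<lambda>t. card {i. i < t \<and> \<not> isdrop i}) in
          (\<forall>t. real t / 3 \<le> real (k t)) \<and>
          (\<forall>t. ereal (hgap X Y L (x t) (y t)) \<le> P * ereal (sqrt (2 * w0) * sqrt ((1 - \<rho>) ^ k t))) \<and>
          (\<forall>T. Min (g ` {..T}) \<le>
                 2 * max (sqrt C) (sqrt w0 * sqrt ((1 - \<rho>) ^ k T)) / \<nu> * (sqrt w0 * sqrt ((1 - \<rho>) ^ k T))))))"
proof -
  obtain \<mu>X \<mu>Y where "0 < \<mu>X" "0 < \<mu>Y" "\<forall>y\<in>Y. strongly_convex_on X \<mu>X (\<lambda>x. L x y)"
    "\<forall>x\<in>X. strongly_convex_on Y \<mu>Y (\<lambda>y. - L x y)"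
    using sc by blast
  then interpret saddle_problem X Y L Gx Gy xs ys \<mu>X \<mu>Y
    using X Y diff saddle curv_fin by unfold_locales auto
  show ?thesis
    unfolding Let_def
    by (intro conjI impI allI; elim conjE) (rule spfw_convergence spafw_convergence; assumption)+
qed

end
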